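(* Let $F=\{2^{k}3^{k'} : k,k'\ge 0\}$. Then $\widetilde{\mathrm{Kaz}}(F)\le 1$. More precisely, for every $\delta\in(0,1/2)$ there exists a continuous probability measure $\mu$ on $\mathbb{T}$ with nonnegative Fourier coefficients such that $$\inf_{k,k'\ge 0}\widehat{\mu}(2^{k}3^{k'})>\delta.$$
   Context: $\mathbb{T}=\{\lambda\in\mathbb{C} : |\lambda|=1\}$. For a finite complex Borel measure $\mu$ on $\mathbb{T}$ and $n\in\mathbb{Z}$, $\widehat{\mu}(n)=\int_{\mathbb{T}}\lambda^{n}\,d\mu(\lambda)$; $\mu$ has nonnegative Fourier coefficients if $\widehat{\mu}(n)\ge 0$ for every $n\in\mathbb{Z}$. A Borel probability measure $\mu$ on $\mathbb{T}$ is continuous if $\mu(\{\lambda\})=0$ for every $\lambda\in\mathbb{T}$. For $Q\subseteq\mathbb{Z}$, the modified Kazhdan constant is $\widetilde{\mathrm{Kaz}}(Q)=\inf_{V}\inf_{\|x\|=1}\sup_{q\in Q}\|V^{q}x-x\|$, where the first infimum is over all unitary operators $V$ without eigenvalues acting on a complex separable Hilbert space $H$ and the second over unit vectors $x\in H$. *)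

theory Defs
  imports "HOL-Probability.Probability_Measure" "HOL-Algebra.Module"
begin

section \<open>Measures on the unit circle\<close>

definition circle_borel :: "complex measure"
  where "circle_borel = restrict_space borel (sphere 0 1)"

definition circle_prob_measure :: "complex measure \<Rightarrow> bool"
  where "circle_prob_measure \<mu> \<longleftrightarrow> prob_space \<mu> \<and> sets \<mu> = sets circle_borel"

definition continuous_measure :: "complex measure \<Rightarrow> bool"
  where "continuous_measure \<mu> \<longleftrightarrow> (\<forall>z\<in>sphere 0 1. measure \<mu> {z} = 0)"

definition fourier_coeff :: "complex measure \<Rightarrow> int \<Rightarrow> complex"
  where "fourier_coeff \<mu> n = (\<integral>z. z powi n \<partial>\<mu>)"

definition nonneg_fourier_coeffs :: "complex measure \<Rightarrow> bool"
  where "nonneg_fourier_coeffs \<mu> \<longleftrightarrow> (\<forall>n. fourier_coeff \<mu> n \<in> \<real>\<^sub>\<ge>\<^sub>0)"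


section \<open>Separable complex Hilbert spaces\<close>

text \<open>
  The Kazhdan constant below quantifies over Hilbert spaces, so a Hilbert space has to be an
  object (a carrier set together with its operations) rather than a type. The fields for
  multiplication and one that the record inherits from rings are not used.
\<close>

definition complex_field :: "complex ring"
  where "complex_field =
    \<lparr>carrier = UNIV, monoid.mult = (*), one = 1, ring.zero = 0, add = (+)\<rparr>"

record 'a inner_space = "(complex, 'a) module" +
  cinner :: "'a \<Rightarrow> 'a \<Rightarrow> complex"

definition hnorm :: "('a, 'b) inner_space_scheme \<Rightarrow> 'a \<Rightarrow> real"
  where "hnorm H x = sqrt (Re (cinner H x x))"

text \<open>
  The operations of \<open>H\<close> are arbitrary outside its carrier; the case distinction makes
  \<open>hdist H\<close> nonnegative and symmetric on the whole type, as the library requires of the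
  distance of a metric space.
\<close>

definition hdist :: "('a, 'b) inner_space_scheme \<Rightarrow> 'a \<Rightarrow> 'a \<Rightarrow> real"
  where "hdist H x y =
    (if x \<in> carrier H \<and> y \<in> carrier H then hnorm H (x \<ominus>\<^bsub>H\<^esub> y) else 0)"

locale complex_inner_product_space = Module.module complex_field H
  for H :: "('a, 'b) inner_space_scheme" (structure) +
  assumes cinner_add_left:
      "\<lbrakk>x \<in> carrier H; y \<in> carrier H; z \<in> carrier H\<rbrakk>
        \<Longrightarrow> cinner H (x \<oplus>\<^bsub>H\<^esub> y) z = cinner H x z + cinner H y z"
    and cinner_smult_left:
      "\<lbrakk>x \<in> carrier H; y \<in> carrier H\<rbrakk> \<Longrightarrow> cinner H (c \<odot>\<^bsub>H\<^esub> x) y = c * cinner H x y"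
    and cinner_commute:
      "\<lbrakk>x \<in> carrier H; y \<in> carrier H\<rbrakk> \<Longrightarrow> cinner H y x = cnj (cinner H x y)"
    and cinner_nonneg:
      "x \<in> carrier H \<Longrightarrow> cinner H x x \<in> \<real>\<^sub>\<ge>\<^sub>0"
    and cinner_definite:
      "\<lbrakk>x \<in> carrier H; cinner H x x = 0\<rbrakk> \<Longrightarrow> x = \<zero>\<^bsub>H\<^esub>"

locale separable_hilbert_space = complex_inner_product_space +
  assumes complete: "Metric_space.mcomplete (carrier H) (hdist H)"
    and separable: "separable_space (Metric_space.mtopology (carrier H) (hdist H))"


section \<open>Unitary operators\<close>

definition unitary_on :: "('a, 'b) inner_space_scheme \<Rightarrow> ('a \<Rightarrow> 'a) \<Rightarrow> bool"
  where "unitary_on H V \<longleftrightarrow>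
    bij_betw V (carrier H) (carrier H) \<and>
    (\<forall>x\<in>carrier H. \<forall>y\<in>carrier H. V (x \<oplus>\<^bsub>H\<^esub> y) = V x \<oplus>\<^bsub>H\<^esub> V y) \<and>
    (\<forall>c. \<forall>x\<in>carrier H. V (c \<odot>\<^bsub>H\<^esub> x) = c \<odot>\<^bsub>H\<^esub> V x) \<and>
    (\<forall>x\<in>carrier H. \<forall>y\<in>carrier H. cinner H (V x) (V y) = cinner H x y)"

definition eigenvalue_on :: "('a, 'b) inner_space_scheme \<Rightarrow> ('a \<Rightarrow> 'a) \<Rightarrow> complex \<Rightarrow> bool"
  where "eigenvalue_on H V c \<longleftrightarrow> (\<exists>x\<in>carrier H. x \<noteq> \<zero>\<^bsub>H\<^esub> \<and> V x = c \<odot>\<^bsub>H\<^esub> x)"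

definition op_powi :: "('a, 'b) inner_space_scheme \<Rightarrow> ('a \<Rightarrow> 'a) \<Rightarrow> int \<Rightarrow> 'a \<Rightarrow> 'a"
  where "op_powi H V q =
    (if 0 \<le> q then V ^^ nat q else inv_into (carrier H) V ^^ nat (- q))"


section \<open>The modified Kazhdan constant\<close>

text \<open>
  A separable Hilbert space has at most the cardinality of the continuum, so up to isometric
  isomorphism every one of them has a carrier contained in the type \<open>nat \<Rightarrow> complex\<close>. The
  vector space operations and the inner product on that carrier are arbitrary, not the
  pointwise ones. Infima and suprema are taken in the extended nonnegative reals, where the
  infimum of the empty set is \<open>\<infinity>\<close> and the zero space does not contribute.
\<close>

definition eigenvalue_free_unitaries ::
    "((nat \<Rightarrow> complex) inner_space \<times> ((nat \<Rightarrow> complex) \<Rightarrow> (nat \<Rightarrow> complex))) set"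
  where "eigenvalue_free_unitaries =
    {(H, V). separable_hilbert_space H \<and> unitary_on H V \<and> (\<nexists>c. eigenvalue_on H V c)}"

definition modified_Kazhdan_constant :: "int set \<Rightarrow> ennreal"
  where "modified_Kazhdan_constant Q =
    (INF (H, V) \<in> eigenvalue_free_unitaries.
      INF x \<in> {x \<in> carrier H. hnorm H x = 1}.
        SUP q \<in> Q. ennreal (hnorm H (op_powi H V q x \<ominus>\<^bsub>H\<^esub> x)))"

definition F_2_3 :: "int set"
  where "F_2_3 = {2 ^ k * 3 ^ k' | k k'. True}"

end

theory Submission
  imports Defs
    "HOL-Probability.Infinite_Product_Measure"
    "HOL-Probability.Probability_Mass_Function"
    "HOL-Library.Poly_Mapping"
begin

text \<open>
  A root of unity of order \<open>2 ^ a\<close> has \<open>n\<close>-th power 1 as soon as \<open>n = 2 ^ k * 3 ^ k'\<close> with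
  \<open>k \<ge> a\<close>, and \<open>n \<le> 6 ^ k\<close> when \<open>k' \<le> k\<close>. Hence, for a sparse sequence of such roots with
  angles \<open>2 ^ - e j\<close>, every such \<open>n\<close> is bad for at most one of them: the earlier ones have
  \<open>n\<close>-th power 1, the later ones are so close to 1 that their \<open>n\<close>-th powers remain close to 1.
  Multiplying the roots selected by independent coins that show heads with small probability gives
  a random point of the circle whose distribution is continuous and has Fourier coefficients
  close to 1 at all \<open>2 ^ k * 3 ^ k'\<close> with \<open>k' \<le> k\<close>. Exchanging 2 and 3 deals with the other half
  of \<open>F\<close>; symmetrizing both measures and averaging them costs the factor 1/2.

  For the Kazhdan constant, multiplication by \<open>z\<close> on \<open>L\<^sup>2(\<mu>)\<close> is realised on an abstract completion
  of the Laurent polynomials. Absence of eigenvalues is read off the form itself: an eigenvector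
  would keep \<open>\<bar>\<langle>U ^ n v, v\<rangle>\<bar>\<close> bounded below for a Laurent polynomial \<open>v\<close> near it, contradicting
  Wiener's lemma.
\<close>

section \<open>Completion of a semi-inner product space\<close>

text \<open>The restriction to \<open>k' \<le> k\<close> bounds \<open>n\<close> by a power whose
  exponent is the same \<open>k\<close> that decides which roots already have \<open>n\<close>-th
  power 1. With \<open>k'\<close> free, \<open>n\<close> could exceed the order of the next root by
  any factor, and nothing would keep the \<open>n\<close>-th powers of the later roots near 1.
  Averaging is harmless only because of the symmetrization. Nothing is known about the coefficient
  that the measure built for the other half of F has at a given \<open>n\<close>; once every
  coefficient is replaced by its squared modulus, it can no longer cancel the good one, and a
  coefficient near 1 stays near 1. The bound 1 for the Kazhdan constant is the same 1/2: for
  multiplication by \<open>z\<close> and the constant function 1, the squared distance between the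
  \<open>q\<close>-th iterate and 1 is 2 minus twice the real part of the \<open>q\<close>-th
  coefficient, so coefficients close to 1/2 give distances close to 1. The space has to have its
  carrier in \<open>nat \<Rightarrow> complex\<close>. Classes of square integrable functions do not
  have this form; inner products with a countable dense family do.\<close>

locale semi_inner_space =
  fixes scl :: "complex \<Rightarrow> 'v::ab_group_add \<Rightarrow> 'v"
    and ip :: "'v \<Rightarrow> 'v \<Rightarrow> complex"
    and D :: "'v set"
  assumes ip_add_left: "ip (x + y) z = ip x z + ip y z"
    and ip_scl_left: "ip (scl c x) y = c * ip x y"
    and ip_commute: "ip y x = cnj (ip x y)"
    and ip_nonneg: "0 \<le> Re (ip x x)"
    and countable_D: "countable D"
    and dense_D: "e > 0 \<Longrightarrow> \<exists>d\<in>D. Re (ip (x - d) (x - d)) < e"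
begin

definition snorm :: "'v \<Rightarrow> real"
  where "snorm x = sqrt (Re (ip x x))"

lemma ip_diff_left: "ip (x - y) z = ip x z - ip y z"
  using ip_add_left[of "x - y" y z] by simp

lemma ip_zero_left [simp]: "ip 0 z = 0"
  using ip_diff_left[of 0 0 z] by simp

lemma ip_add_right: "ip x (y + z) = ip x y + ip x z"
  by (subst (1 2 3) ip_commute) (simp add: ip_add_left)

lemma ip_diff_right: "ip x (y - z) = ip x y - ip x z"
  by (subst (1 2 3) ip_commute) (simp add: ip_diff_left)

lemma ip_scl_right: "ip x (scl c y) = cnj c * ip x y"
  by (subst (1 2) ip_commute) (simp add: ip_scl_left)

lemma ip_self: "ip x x = of_real ((snorm x)\<^sup>2)"
proof -
  have "Im (ip x x) = - Im (ip x x)"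
    by (subst ip_commute) simp
  then show ?thesis
    using ip_nonneg[of x] by (simp add: snorm_def complex_eq_iff)
qed

lemma snorm_nonneg [simp]: "0 \<le> snorm x"
  by (simp add: snorm_def ip_nonneg)

lemma snorm_zero [simp]: "snorm 0 = 0"
  by (simp add: snorm_def)

lemma Cauchy_Schwarz: "cmod (ip x y) \<le> snorm x * snorm y"
proof -
  define a where "a = ip x y"
  \<comment> \<open>This is the squared seminorm of \<open>x - scl c y\<close> with
    \<open>c = t * a\<close>; the factor \<open>a\<close> aligns the phases and makes the cross
    terms real.\<close>
  have expand: "0 \<le> (snorm x)\<^sup>2 - 2 * t * (cmod a)\<^sup>2 + t\<^sup>2 * (cmod a)\<^sup>2 * (snorm y)\<^sup>2" for t :: real
  proof -
    define c where "c = of_real t * a"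
    have "ip (x - scl c y) (x - scl c y) = ip x x - cnj c * a - c * cnj a + c * cnj c * ip y y"
      using ip_commute[of y x]
      by (simp add: ip_diff_left ip_diff_right ip_scl_left ip_scl_right a_def algebra_simps)
    also have "\<dots> = of_real ((snorm x)\<^sup>2 - 2 * t * (cmod a)\<^sup>2 + t\<^sup>2 * (cmod a)\<^sup>2 * (snorm y)\<^sup>2)"
      unfolding ip_self c_def of_real_add of_real_diff of_real_mult complex_norm_square
      by (simp add: power2_eq_square algebra_simps)
    finally show ?thesis
      using ip_nonneg[of "x - scl c y"] by simp
  qed
  have "(cmod a)\<^sup>2 \<le> (snorm x * snorm y)\<^sup>2"
  proof (cases "snorm y = 0")
    case True
    \<comment> \<open>With \<open>snorm y = 0\<close> the expression is affine in \<open>t\<close>,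
      and for \<open>a \<noteq> 0\<close> the \<open>t\<close> chosen below gives it the value
      -1.\<close>
    have "(cmod a)\<^sup>2 = 0"
    proof (rule ccontr)
      assume "(cmod a)\<^sup>2 \<noteq> 0"
      then show False
        using expand[of "((snorm x)\<^sup>2 + 1) / (2 * (cmod a)\<^sup>2)"] True by (simp add: field_simps)
    qed
    then show ?thesis
      by simp
  next
    case False
    then have pos: "(snorm y)\<^sup>2 > 0"
      by simp
    \<comment> \<open>The quadratic is evaluated at its minimum,
      \<open>t = 1 / (snorm y)\<^sup>2\<close>.\<close>
    have "0 \<le> (snorm x)\<^sup>2 - (cmod a)\<^sup>2 / (snorm y)\<^sup>2"
      using expand[of "1 / (snorm y)\<^sup>2"] False by (simp add: power2_eq_square)
    then show ?thesis
      using pos by (simp add: divide_le_eq power_mult_distrib)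
  qed
  then show ?thesis
    unfolding a_def by (rule power2_le_imp_le) simp
qed

lemma snorm_triangle: "snorm (x + y) \<le> snorm x + snorm y"
proof -
  have "Re (ip (x + y) (x + y)) = (snorm x)\<^sup>2 + (snorm y)\<^sup>2 + 2 * Re (ip x y)"
    using ip_self[of x] ip_self[of y] ip_commute[of x y]
    by (simp add: ip_add_left ip_add_right)
  also have "\<dots> \<le> (snorm x + snorm y)\<^sup>2"
    using Cauchy_Schwarz[of x y] complex_Re_le_cmod[of "ip x y"] by (simp add: power2_sum)
  finally show ?thesis
    unfolding snorm_def[of "x + y"] by (simp add: real_le_lsqrt)
qed

lemma snorm_scl: "snorm (scl c x) = cmod c * snorm x"
proof -
  have "ip (scl c x) (scl c x) = of_real ((cmod c * snorm x)\<^sup>2)"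
    unfolding ip_scl_left ip_scl_right ip_self[of x] power_mult_distrib of_real_mult
      complex_norm_square by simp
  then show ?thesis
    unfolding snorm_def[of "scl c x"] by (simp add: abs_mult)
qed

lemma snorm_minus_commute: "snorm (x - y) = snorm (y - x)"
  by (simp add: snorm_def ip_diff_left ip_diff_right)

lemma snorm_triangle_diff: "snorm (x - z) \<le> snorm (x - y) + snorm (y - z)"
  using snorm_triangle[of "x - y" "y - z"] by simp

lemma abs_snorm_diff: "\<bar>snorm x - snorm y\<bar> \<le> snorm (x - y)"
  using snorm_triangle[of "x - y" y] snorm_triangle[of "y - x" x] snorm_minus_commute[of x y] by simp

section \<open>Cauchy sequences for the seminorm\<close>

definition scauchy :: "(nat \<Rightarrow> 'v) \<Rightarrow> bool"
  where "scauchy p \<longleftrightarrow> (\<forall>e>0. \<exists>N. \<forall>m\<ge>N. \<forall>n\<ge>N. snorm (p m - p n) < e)"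

lemma scauchyD: "scauchy p \<Longrightarrow> e > 0 \<Longrightarrow> \<exists>N. \<forall>m\<ge>N. \<forall>n\<ge>N. snorm (p m - p n) < e"
  unfolding scauchy_def by blast

lemma scauchy_const: "scauchy (\<lambda>_. v)"
  unfolding scauchy_def by simp

lemma scauchy_add:
  assumes "scauchy p" "scauchy q"
  shows "scauchy (\<lambda>j. p j + q j)"
  unfolding scauchy_def
proof (intro allI impI)
  fix e :: real
  assume "e > 0"
  then obtain M N where MN: "\<And>m n. m \<ge> M \<Longrightarrow> n \<ge> M \<Longrightarrow> snorm (p m - p n) < e / 2"
    "\<And>m n. m \<ge> N \<Longrightarrow> n \<ge> N \<Longrightarrow> snorm (q m - q n) < e / 2"
    using scauchyD[OF assms(1), of "e / 2"] scauchyD[OF assms(2), of "e / 2"] by (metis half_gt_zero)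
  have "snorm (p m + q m - (p n + q n)) < e" if "m \<ge> max M N" "n \<ge> max M N" for m n
    using MN(1)[of m n] MN(2)[of m n] snorm_triangle[of "p m - p n" "q m - q n"] that
    by (simp add: algebra_simps)
  then show "\<exists>N. \<forall>m\<ge>N. \<forall>n\<ge>N. snorm (p m + q m - (p n + q n)) < e"
    by blast
qed

lemma scauchy_bounded:
  assumes "scauchy p"
  obtains B where "B > 0" "\<And>n. snorm (p n) \<le> B"
proof -
  have "Cauchy (\<lambda>n. snorm (p n))"
  proof (rule CauchyI)
    fix e :: real
    assume "e > 0"
    then show "\<exists>M. \<forall>m\<ge>M. \<forall>n\<ge>M. norm (snorm (p m) - snorm (p n)) < e"
      using scauchyD[OF assms] abs_snorm_diff by (metis real_norm_def order_le_less_trans)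
  qed
  then have "Bseq (\<lambda>n. snorm (p n))"
    by (rule Cauchy_Bseq)
  then show ?thesis
    using that unfolding Bseq_def by auto
qed

lemma ip_Cauchy:
  assumes "scauchy p" "scauchy q"
  shows "Cauchy (\<lambda>j. ip (p j) (q j))"
proof (rule CauchyI)
  fix e :: real
  assume e: "e > 0"
  obtain A where A: "A > 0" "\<And>n. snorm (p n) \<le> A"
    using scauchy_bounded[OF assms(1)] by blast
  obtain B where B: "B > 0" "\<And>n. snorm (q n) \<le> B"
    using scauchy_bounded[OF assms(2)] by blast
  obtain M where M: "\<And>m n. m \<ge> M \<Longrightarrow> n \<ge> M \<Longrightarrow> snorm (p m - p n) < e / (2 * B)"
    using scauchyD[OF assms(1), of "e / (2 * B)"] B(1) e by auto
  obtain N where N: "\<And>m n. m \<ge> N \<Longrightarrow> n \<ge> N \<Longrightarrow> snorm (q m - q n) < e / (2 * A)"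
    using scauchyD[OF assms(2), of "e / (2 * A)"] A(1) e by auto
  have "norm (ip (p m) (q m) - ip (p n) (q n)) < e" if "m \<ge> max M N" "n \<ge> max M N" for m n
  proof -
    have "ip (p m) (q m) - ip (p n) (q n) = ip (p m - p n) (q m) + ip (p n) (q m - q n)"
      by (simp add: ip_diff_left ip_diff_right)
    also have "norm \<dots> \<le> snorm (p m - p n) * snorm (q m) + snorm (p n) * snorm (q m - q n)"
      by (meson Cauchy_Schwarz add_mono norm_triangle_ineq order_trans)
    also have "\<dots> < (e / (2 * B)) * B + A * (e / (2 * A))"
    proof (rule add_less_le_mono)
      have "snorm (p m - p n) * snorm (q m) \<le> snorm (p m - p n) * B"
        by (simp add: B mult_left_mono)
      also have "\<dots> < (e / (2 * B)) * B"
        using M[of m n] that B(1) by (intro mult_strict_right_mono) auto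
      finally show "snorm (p m - p n) * snorm (q m) < (e / (2 * B)) * B" .
      show "snorm (p n) * snorm (q m - q n) \<le> A * (e / (2 * A))"
        using N[of m n] that A by (intro mult_mono) (auto simp: less_imp_le)
    qed
    also have "\<dots> = e"
      using A B by simp
    finally show ?thesis .
  qed
  then show "\<exists>M. \<forall>m\<ge>M. \<forall>n\<ge>M. norm (ip (p m) (q m) - ip (p n) (q n)) < e"
    by blast
qed

section \<open>A dense sequence and the codes of Cauchy sequences\<close>

lemma D_nonempty: "D \<noteq> {}"
  using dense_D[of 1 0] by auto

definition enum :: "nat \<Rightarrow> 'v"
  where "enum = from_nat_into D"

lemma enum_dense: "e > 0 \<Longrightarrow> \<exists>i. snorm (x - enum i) < e"
proof -
  assume e: "e > 0"
  then obtain d where d: "d \<in> D" "Re (ip (x - d) (x - d)) < e\<^sup>2"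
    using dense_D[of "e\<^sup>2" x] by auto
  have "snorm (x - d) < e"
    unfolding snorm_def using d(2) e by (simp add: real_less_lsqrt)
  moreover obtain i where "enum i = d"
    using d(1) from_nat_into_surj[OF countable_D] unfolding enum_def by blast
  ultimately show ?thesis
    by blast
qed

text \<open>
  A Cauchy sequence is encoded by the limits of its inner products with the dense sequence; two
  Cauchy sequences get the same code exactly when their difference tends to 0 in seminorm. This
  realises the completion inside \<open>nat \<Rightarrow> complex\<close> with pointwise operations.
\<close>

definition represents :: "(nat \<Rightarrow> 'v) \<Rightarrow> (nat \<Rightarrow> complex) \<Rightarrow> bool"
  where "represents p a \<longleftrightarrow> scauchy p \<and> (\<forall>i. (\<lambda>j. ip (p j) (enum i)) \<longlonglongrightarrow> a i)"

lemma represents_scauchy: "represents p a \<Longrightarrow> scauchy p"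
  unfolding represents_def by blast

lemma scauchy_represents:
  assumes "scauchy p"
  obtains a where "represents p a"
proof -
  have "\<exists>l. (\<lambda>j. ip (p j) (enum i)) \<longlonglongrightarrow> l" for i
    using ip_Cauchy[OF assms scauchy_const] by (simp add: Cauchy_convergent_iff convergent_def)
  then show ?thesis
    using that assms unfolding represents_def by metis
qed

lemma represents_unique: "represents p a \<Longrightarrow> represents p b \<Longrightarrow> a = b"
  unfolding represents_def by (metis LIMSEQ_unique ext)

lemma represents_add:
  "represents p a \<Longrightarrow> represents q b \<Longrightarrow> represents (\<lambda>j. p j + q j) (\<lambda>i. a i + b i)"
  unfolding represents_def by (auto simp: scauchy_add ip_add_left intro: tendsto_add)

lemma represents_minus:
  assumes "represents p a"
  shows "represents (\<lambda>j. - p j) (\<lambda>i. - a i)"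
proof -
  have [simp]: "ip (- x) y = - ip x y" for x y
    using ip_diff_left[of 0 x y] by simp
  have "snorm (- p m - - p n) = snorm (p m - p n)" for m n
    by (subst snorm_minus_commute) simp
  then show ?thesis
    using assms unfolding represents_def scauchy_def by (auto intro: tendsto_minus)
qed

lemma represents_diff:
  "represents p a \<Longrightarrow> represents q b \<Longrightarrow> represents (\<lambda>j. p j - q j) (\<lambda>i. a i - b i)"
  using represents_add[OF _ represents_minus] by fastforce

lemma represents_scl:
  assumes "represents p a"
  shows "represents (\<lambda>j. scl c (p j)) (\<lambda>i. c * a i)"
proof -
  \<comment> \<open>The locale describes \<open>scl\<close> only through \<open>ip\<close>, so
    \<open>scl c x - scl c y\<close> and \<open>scl c (x - y)\<close> are compared through their
    inner products, not as vectors.\<close>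
  have eq: "snorm (scl c x - scl c y) = cmod c * snorm (x - y)" for x y
  proof -
    have "ip (scl c x - scl c y) z = ip (scl c (x - y)) z" for z
      by (simp add: ip_diff_left ip_scl_left algebra_simps)
    then have "ip (scl c x - scl c y) (scl c x - scl c y) = ip (scl c (x - y)) (scl c (x - y))"
      by (metis ip_commute)
    then show ?thesis
      using snorm_scl[of c "x - y"] by (simp add: snorm_def)
  qed
  have "scauchy (\<lambda>j. scl c (p j))"
    unfolding scauchy_def
  proof (intro allI impI)
    fix e :: real
    assume "e > 0"
    then obtain N where N: "\<And>m n. m \<ge> N \<Longrightarrow> n \<ge> N \<Longrightarrow> snorm (p m - p n) < e / (cmod c + 1)"
      using scauchyD[OF represents_scauchy[OF assms], of "e / (cmod c + 1)"]
      by (auto simp: add_nonneg_pos)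
    have "snorm (scl c (p m) - scl c (p n)) < e" if "m \<ge> N" "n \<ge> N" for m n
    proof -
      have "cmod c * snorm (p m - p n) \<le> (cmod c + 1) * snorm (p m - p n)"
        by (simp add: mult_right_mono)
      also have "\<dots> < e"
        using N[OF that] by (simp add: field_simps add_pos_nonneg)
      finally show ?thesis
        by (simp add: eq)
    qed
    then show "\<exists>N. \<forall>m\<ge>N. \<forall>n\<ge>N. snorm (scl c (p m) - scl c (p n)) < e"
      by blast
  qed
  then show ?thesis
    using assms unfolding represents_def by (auto simp: ip_scl_left intro: tendsto_mult_left)
qed

definition emb :: "'v \<Rightarrow> nat \<Rightarrow> complex"
  where "emb v = (\<lambda>i. ip v (enum i))"

lemma represents_emb: "represents (\<lambda>_. v) (emb v)"
  unfolding represents_def emb_def by (simp add: scauchy_const)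

text \<open>A Cauchy sequence that tends weakly to 0 tends to 0 in seminorm, which is why equal
  codes mean equal limits. Boundedness extends the weak convergence from the dense sequence to all
  vectors. Then the square of \<open>snorm (r j)\<close> is split into the inner products of
  \<open>r j\<close> with \<open>r j - r N\<close>, small by the Cauchy property, and with the fixed
  vector \<open>r N\<close>, small by weak convergence.\<close>

lemma represents_zero_imp_null:
  assumes "represents r (\<lambda>_. 0)"
  shows "(\<lambda>j. snorm (r j)) \<longlonglongrightarrow> 0"
proof -
  have scauchy: "scauchy r"
    using assms by (rule represents_scauchy)
  obtain B where B: "B > 0" "\<And>n. snorm (r n) \<le> B"
    using scauchy_bounded[OF scauchy] by blast
  have weak: "(\<lambda>j. ip (r j) v) \<longlonglongrightarrow> 0" for v
  proof (rule LIMSEQ_I)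
    fix e :: real
    assume e: "e > 0"
    then obtain i where i: "snorm (v - enum i) < e / (2 * B)"
      using enum_dense[of "e / (2 * B)" v] B(1) by auto
    obtain N where N: "\<And>j. j \<ge> N \<Longrightarrow> norm (ip (r j) (enum i)) < e / 2"
      using assms e unfolding represents_def LIMSEQ_iff
      by (metis diff_zero half_gt_zero)
    have "norm (ip (r j) v - 0) < e" if "j \<ge> N" for j
    proof -
      have "norm (ip (r j) v) = norm (ip (r j) (v - enum i) + ip (r j) (enum i))"
        by (simp add: ip_diff_right)
      also have "\<dots> \<le> snorm (r j) * snorm (v - enum i) + norm (ip (r j) (enum i))"
        by (meson Cauchy_Schwarz add_right_mono norm_triangle_ineq order_trans)
      also have "\<dots> < B * (e / (2 * B)) + e / 2"
        using N[OF that] i B by (intro add_le_less_mono mult_mono) (auto simp: less_imp_le)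
      also have "\<dots> = e"
        using B(1) by simp
      finally show ?thesis
        by simp
    qed
    then show "\<exists>N. \<forall>j\<ge>N. norm (ip (r j) v - 0) < e"
      by blast
  qed
  show ?thesis
  proof (rule LIMSEQ_I)
    fix e :: real
    assume e: "e > 0"
    then have "e\<^sup>2 / (2 * B) > 0"
      using B(1) by simp
    then obtain N where N: "\<And>m n. m \<ge> N \<Longrightarrow> n \<ge> N \<Longrightarrow> snorm (r m - r n) < e\<^sup>2 / (2 * B)"
      using scauchyD[OF scauchy] by blast
    have "e\<^sup>2 / 2 > 0"
      using e by simp
    then obtain M where M: "\<And>j. j \<ge> M \<Longrightarrow> norm (ip (r j) (r N)) < e\<^sup>2 / 2"
      using weak[of "r N"] unfolding LIMSEQ_iff by (metis diff_zero)
    have "norm (snorm (r j) - 0) < e" if "j \<ge> max M N" for j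
    proof -
      have "(snorm (r j))\<^sup>2 = norm (ip (r j) (r j))"
        by (simp add: ip_self norm_power)
      also have "\<dots> = norm (ip (r j) (r j - r N) + ip (r j) (r N))"
        by (simp add: ip_diff_right)
      also have "\<dots> \<le> snorm (r j) * snorm (r j - r N) + norm (ip (r j) (r N))"
        by (meson Cauchy_Schwarz add_right_mono norm_triangle_ineq order_trans)
      also have "\<dots> < B * (e\<^sup>2 / (2 * B)) + e\<^sup>2 / 2"
        using M[of j] N[of j N] that B
        by (intro add_le_less_mono mult_mono) (auto simp: less_imp_le)
      also have "\<dots> = e\<^sup>2"
        using B(1) by simp
      finally show ?thesis
        using e power2_less_imp_less[of "snorm (r j)" e] by simp
    qed
    then show "\<exists>N. \<forall>j\<ge>N. norm (snorm (r j) - 0) < e"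
      by blast
  qed
qed

lemma ip_tendsto_zero:
  assumes "(\<lambda>j. snorm (r j)) \<longlonglongrightarrow> 0" "scauchy q"
  shows "(\<lambda>j. ip (r j) (q j)) \<longlonglongrightarrow> 0" "(\<lambda>j. ip (q j) (r j)) \<longlonglongrightarrow> 0"
proof -
  obtain B where B: "B > 0" "\<And>n. snorm (q n) \<le> B"
    using scauchy_bounded[OF assms(2)] by blast
  have bound: "(\<lambda>j. snorm (r j) * B) \<longlonglongrightarrow> 0"
    using tendsto_mult_right[OF assms(1), of B] by simp
  have le: "cmod (ip (r j) (q j)) \<le> snorm (r j) * B" for j
    using Cauchy_Schwarz[of "r j" "q j"] B(2)[of j]
    by (meson mult_left_mono order_trans snorm_nonneg)
  show "(\<lambda>j. ip (r j) (q j)) \<longlonglongrightarrow> 0"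
    by (rule Lim_null_comparison[OF _ bound]) (simp add: le)
  have "cmod (ip (q j) (r j)) \<le> snorm (r j) * B" for j
    using le[of j] ip_commute[of "q j" "r j"] by simp
  then show "(\<lambda>j. ip (q j) (r j)) \<longlonglongrightarrow> 0"
    by (intro Lim_null_comparison[OF _ bound]) simp
qed

definition repr :: "(nat \<Rightarrow> complex) \<Rightarrow> nat \<Rightarrow> 'v"
  where "repr a = (SOME p. represents p a)"

lemma represents_repr: "represents p a \<Longrightarrow> represents (repr a) a"
  unfolding repr_def using someI[where P = "\<lambda>p. represents p a"] .

definition hip :: "(nat \<Rightarrow> complex) \<Rightarrow> (nat \<Rightarrow> complex) \<Rightarrow> complex"
  where "hip a b = lim (\<lambda>j. ip (repr a j) (repr b j))"

lemma represents_diff_null: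
  assumes "represents p a" "represents q a"
  shows "(\<lambda>j. snorm (p j - q j)) \<longlonglongrightarrow> 0"
  using represents_diff[OF assms] by (intro represents_zero_imp_null) simp

text \<open>Independence of the chosen representatives: replacing either sequence by another one
  with the same code changes it by a null sequence. From here on any convenient representatives may
  be used to compute \<open>hip\<close>.\<close>

lemma hip_tendsto:
  assumes p: "represents p a" and q: "represents q b"
  shows "(\<lambda>j. ip (p j) (q j)) \<longlonglongrightarrow> hip a b"
proof -
  note p' = represents_repr[OF p] and q' = represents_repr[OF q]
  have "(\<lambda>j. ip (p j - repr a j) (q j) + ip (repr a j) (q j - repr b j)) \<longlonglongrightarrow> 0 + 0"
    using represents_diff_null[OF p p'] represents_diff_null[OF q q'] represents_scauchy[OF q]
      represents_scauchy[OF p'] by (intro tendsto_add ip_tendsto_zero)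
  moreover have "(\<lambda>j. ip (repr a j) (repr b j)) \<longlonglongrightarrow> hip a b"
    unfolding hip_def using ip_Cauchy[OF represents_scauchy[OF p'] represents_scauchy[OF q']]
    by (simp add: Cauchy_convergent_iff convergent_LIMSEQ_iff)
  ultimately have "(\<lambda>j. ip (p j - repr a j) (q j) + ip (repr a j) (q j - repr b j)
      + ip (repr a j) (repr b j)) \<longlonglongrightarrow> 0 + 0 + hip a b"
    by (rule tendsto_add)
  then show ?thesis
    by (simp add: ip_diff_left ip_diff_right)
qed

lemma hip_eqI:
  assumes "represents p a" "represents q b" "(\<lambda>j. ip (p j) (q j)) \<longlonglongrightarrow> l"
  shows "hip a b = l"
  using hip_tendsto[OF assms(1,2)] assms(3) by (rule LIMSEQ_unique)

lemma hip_emb: "hip (emb x) (emb y) = ip x y"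
  by (rule hip_eqI[OF represents_emb represents_emb]) simp

section \<open>The completion as a separable Hilbert space\<close>

definition completion :: "(nat \<Rightarrow> complex) inner_space"
  where "completion = \<lparr>carrier = {a. \<exists>p. represents p a}, monoid.mult = (\<lambda>a b i. a i * b i),
    one = (\<lambda>_. 1), ring.zero = (\<lambda>_. 0), add = (\<lambda>a b i. a i + b i),
    smult = (\<lambda>c a i. c * a i), cinner = hip\<rparr>"

lemma completion_sel [simp]:
  "carrier completion = {a. \<exists>p. represents p a}"
  "\<zero>\<^bsub>completion\<^esub> = (\<lambda>_. 0)"
  "a \<oplus>\<^bsub>completion\<^esub> b = (\<lambda>i. a i + b i)"
  "c \<odot>\<^bsub>completion\<^esub> a = (\<lambda>i. c * a i)"
  "cinner completion = hip"
  by (simp_all add: completion_def)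

lemma represents_zero: "represents (\<lambda>_. 0) (\<lambda>_. 0)"
  using represents_emb[of 0] by (simp add: emb_def)

lemma abelian_group_completion: "abelian_group completion"
proof (rule abelian_groupI)
  fix a
  assume "a \<in> carrier completion"
  then obtain p where "represents p a"
    by auto
  then have "(\<lambda>i. - a i) \<in> carrier completion"
    using represents_minus by auto
  then show "\<exists>b\<in>carrier completion. b \<oplus>\<^bsub>completion\<^esub> a = \<zero>\<^bsub>completion\<^esub>"
    by (rule bexI[rotated]) simp
qed (auto simp: algebra_simps intro: represents_zero dest: represents_add)

lemma cring_complex_field: "cring complex_field"
proof (rule cringI)
  show "abelian_group complex_field"
    by (rule abelian_groupI)
      (auto simp: complex_field_def add.commute intro: exI[of _ "- x" for x])
  show "Group.comm_monoid complex_field"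
    by (rule Group.comm_monoidI) (auto simp: complex_field_def)
qed (auto simp: complex_field_def algebra_simps)

lemma module_completion: "Module.module complex_field completion"
  by (rule moduleI[OF cring_complex_field abelian_group_completion])
    (use represents_scl in \<open>auto simp: complex_field_def algebra_simps\<close>)

lemma a_minus_completion:
  assumes "a \<in> carrier completion" "b \<in> carrier completion"
  shows "a \<ominus>\<^bsub>completion\<^esub> b = (\<lambda>i. a i - b i)"
proof -
  interpret abelian_group completion
    by (rule abelian_group_completion)
  have "(\<lambda>i. - b i) \<in> carrier completion"
    using assms(2) represents_minus by auto
  then have "\<ominus>\<^bsub>completion\<^esub> b = (\<lambda>i. - b i)"
    using assms(2) by (intro minus_equality) auto
  then show ?thesis
    by (simp add: a_minus_def)
qed

lemma hip_snorm_tendsto: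
  assumes "represents p a"
  shows "(\<lambda>j. snorm (p j)) \<longlonglongrightarrow> hnorm completion a"
  unfolding snorm_def hnorm_def completion_sel
  by (intro tendsto_intros hip_tendsto assms)

lemma hnorm_emb: "hnorm completion (emb v) = snorm v"
  by (simp add: hnorm_def hip_emb snorm_def)

lemma hnorm_emb_diff:
  "hnorm completion (\<lambda>i. emb x i - emb y i) = snorm (x - y)"
  using hip_snorm_tendsto[OF represents_diff[OF represents_emb represents_emb], of x y]
  by (simp add: LIMSEQ_const_iff)

lemma hip_self: "represents p a \<Longrightarrow> hip a a = of_real ((hnorm completion a)\<^sup>2)"
  by (rule hip_eqI)
    (auto simp: ip_self simp del: of_real_power intro!: tendsto_of_real tendsto_power hip_snorm_tendsto)

lemma hnorm_nonneg: "represents p a \<Longrightarrow> 0 \<le> hnorm completion a"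
  by (rule LIMSEQ_le_const[OF hip_snorm_tendsto]) auto

lemma hnorm_zero_imp:
  assumes "represents p a" "hnorm completion a = 0"
  shows "a = (\<lambda>_. 0)"
proof
  fix i
  have "(\<lambda>j. ip (p j) (enum i)) \<longlonglongrightarrow> 0"
    using hip_snorm_tendsto[OF assms(1)] assms(2) by (intro ip_tendsto_zero scauchy_const) simp
  then show "a i = 0"
    using assms(1) LIMSEQ_unique unfolding represents_def by blast
qed

lemma inner_product_space_completion: "complex_inner_product_space completion"
proof (intro complex_inner_product_space.intro module_completion
    complex_inner_product_space_axioms.intro)
  fix a b z
  assume "a \<in> carrier completion" "b \<in> carrier completion" "z \<in> carrier completion"
  then obtain p q r where "represents p a" "represents q b" "represents r z"
    by auto
  then show "cinner completion (a \<oplus>\<^bsub>completion\<^esub> b) z = cinner completion a z + cinner completion b z"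
    by (auto simp: ip_add_left intro!: hip_eqI[OF represents_add] tendsto_add hip_tendsto)
next
  fix a b c
  assume "a \<in> carrier completion" "b \<in> carrier completion"
  then obtain p q where "represents p a" "represents q b"
    by auto
  then show "cinner completion (c \<odot>\<^bsub>completion\<^esub> a) b = c * cinner completion a b"
    by (auto simp: ip_scl_left intro!: hip_eqI[OF represents_scl] tendsto_mult_left hip_tendsto)
next
  fix a b
  assume "a \<in> carrier completion" "b \<in> carrier completion"
  then obtain p q where pq: "represents p a" "represents q b"
    by auto
  have "(\<lambda>j. ip (q j) (p j)) \<longlonglongrightarrow> cnj (hip a b)"
    by (subst ip_commute) (intro tendsto_cnj hip_tendsto pq)
  then show "cinner completion b a = cnj (cinner completion a b)"
    using hip_eqI[OF pq(2,1)] by simp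
next
  fix a
  assume "a \<in> carrier completion"
  then show "cinner completion a a \<in> \<real>\<^sub>\<ge>\<^sub>0"
    by (auto simp: hip_self simp del: of_real_power)
next
  fix a
  assume "a \<in> carrier completion" "cinner completion a a = 0"
  then show "a = \<zero>\<^bsub>completion\<^esub>"
    using hnorm_zero_imp by (auto simp: hip_self)
qed

lemma hnorm_triangle:
  assumes a: "represents p a" and b: "represents q b" and c: "represents r c"
  shows "hnorm completion (\<lambda>i. a i - c i)
    \<le> hnorm completion (\<lambda>i. a i - b i) + hnorm completion (\<lambda>i. b i - c i)"
  by (rule LIMSEQ_le[OF hip_snorm_tendsto[OF represents_diff[OF a c]]
        tendsto_add[OF hip_snorm_tendsto[OF represents_diff[OF a b]]
          hip_snorm_tendsto[OF represents_diff[OF b c]]]])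
    (auto intro: snorm_triangle_diff)

lemma hnorm_diff_commute:
  assumes a: "represents p a" and b: "represents q b"
  shows "hnorm completion (\<lambda>i. a i - b i) = hnorm completion (\<lambda>i. b i - a i)"
  using hip_snorm_tendsto[OF represents_diff[OF a b]] hip_snorm_tendsto[OF represents_diff[OF b a]]
  by (subst (asm) snorm_minus_commute) (rule LIMSEQ_unique)

lemma hdist_completion:
  "represents p a \<Longrightarrow> represents q b \<Longrightarrow>
    hdist completion a b = hnorm completion (\<lambda>i. a i - b i)"
  using a_minus_completion[of a b] by (auto simp: hdist_def)

lemma Metric_space_completion: "Metric_space (carrier completion) (hdist completion)"
proof
  fix a b
  show "0 \<le> hdist completion a b"
    using hdist_completion[of _ a _ b] hnorm_nonneg[OF represents_diff, of _ a _ b]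
    by (cases "a \<in> carrier completion \<and> b \<in> carrier completion") (auto simp: hdist_def)
  show "hdist completion a b = hdist completion b a"
    using hdist_completion[of _ a _ b] hdist_completion[of _ b _ a] hnorm_diff_commute[of _ a _ b]
    by (cases "a \<in> carrier completion \<and> b \<in> carrier completion") (auto simp: hdist_def)
next
  fix a b
  assume "a \<in> carrier completion" "b \<in> carrier completion"
  then obtain p q where pq: "represents p a" "represents q b"
    by auto
  show "hdist completion a b = 0 \<longleftrightarrow> a = b"
  proof
    assume "hdist completion a b = 0"
    then have "(\<lambda>i. a i - b i) = (\<lambda>_. 0)"
      using hnorm_zero_imp[OF represents_diff[OF pq]] hdist_completion[OF pq] by simp
    then show "a = b"
      by (simp add: fun_eq_iff)
  next
    assume "a = b"
    then show "hdist completion a b = 0"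
      using hdist_completion[OF pq] hnorm_emb[of 0] by (simp add: emb_def)
  qed
next
  fix a b c
  assume "a \<in> carrier completion" "b \<in> carrier completion" "c \<in> carrier completion"
  then obtain p q r where "represents p a" "represents q b" "represents r c"
    by auto
  then show "hdist completion a c \<le> hdist completion a b + hdist completion b c"
    using hnorm_triangle by (simp add: hdist_completion)
qed

lemma hdist_emb: "hdist completion (emb x) (emb y) = snorm (x - y)"
  by (simp add: hdist_completion[OF represents_emb represents_emb] hnorm_emb_diff)

lemma hdist_emb_tendsto:
  assumes "represents p a"
  shows "(\<lambda>j. hdist completion a (emb (p j))) \<longlonglongrightarrow> 0"
proof (rule LIMSEQ_I)
  fix e :: real
  assume "e > 0"
  then obtain N where N: "\<And>m n. m \<ge> N \<Longrightarrow> n \<ge> N \<Longrightarrow> snorm (p m - p n) < e / 2"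
    using scauchyD[OF represents_scauchy[OF assms], of "e / 2"] by auto
  have "norm (hdist completion a (emb (p j)) - 0) < e" if "j \<ge> N" for j
  proof -
    have "hdist completion a (emb (p j)) \<le> e / 2"
      unfolding hdist_completion[OF assms represents_emb]
      using N[OF _ that]
      by (intro LIMSEQ_le_const2[OF hip_snorm_tendsto[OF represents_diff[OF assms represents_emb]]]
          exI[of _ N]) (auto simp: less_imp_le)
    moreover have "0 \<le> hdist completion a (emb (p j))"
      unfolding hdist_completion[OF assms represents_emb]
      by (rule hnorm_nonneg[OF represents_diff[OF assms represents_emb]])
    ultimately show ?thesis
      using \<open>e > 0\<close> by simp
  qed
  then show "\<exists>N. \<forall>j\<ge>N. norm (hdist completion a (emb (p j)) - 0) < e"
    by blast
qed

lemma emb_dense: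
  assumes "a \<in> carrier completion" "e > 0"
  shows "\<exists>v. hdist completion a (emb v) < e"
proof -
  obtain p where "represents p a"
    using assms(1) by auto
  then have "\<forall>\<^sub>F j in sequentially. hdist completion a (emb (p j)) < e"
    using order_tendstoD(2)[OF hdist_emb_tendsto] assms(2) by blast
  then show ?thesis
    by (auto simp: eventually_sequentially)
qed

lemma emb_carrier [simp]: "emb v \<in> carrier completion"
  using represents_emb by auto

text \<open>For completeness, the \<open>n\<close>-th term of a Cauchy sequence of codes is replaced
  by an embedded vector at distance less than \<open>1 / (n + 1)\<close>. These vectors form a
  Cauchy sequence in the original space, and the code of that sequence is the limit. For
  separability, two approximations are chained: of a code by an embedded vector, and of that vector
  by an element of \<open>D\<close>.\<close>

lemma separable_hilbert_space_completion: "separable_hilbert_space completion"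
proof (intro separable_hilbert_space.intro inner_product_space_completion
    separable_hilbert_space_axioms.intro)
  interpret M: Metric_space "carrier completion" "hdist completion"
    by (rule Metric_space_completion)
  show "M.mcomplete"
    unfolding M.mcomplete_def
  proof (intro allI impI)
    fix \<sigma>
    assume Cauchy: "M.MCauchy \<sigma>"
    then have \<sigma>: "\<sigma> n \<in> carrier completion" for n
      unfolding M.MCauchy_def by blast
    have "\<exists>v. hdist completion (\<sigma> n) (emb v) < inverse (real (Suc n))" for n
      by (rule emb_dense[OF \<sigma>]) simp
    then obtain p where p: "\<And>n. hdist completion (\<sigma> n) (emb (p n)) < inverse (real (Suc n))"
      by metis
    have "scauchy p"
      unfolding scauchy_def
    proof (intro allI impI)
      fix e :: real
      assume "e > 0"
      then have e3: "e / 3 > 0"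
        by simp
      obtain N1 where N1: "\<And>m n. m \<ge> N1 \<Longrightarrow> n \<ge> N1 \<Longrightarrow> hdist completion (\<sigma> m) (\<sigma> n) < e / 3"
        using Cauchy e3 unfolding M.MCauchy_def by blast
      obtain N2 where N2: "inverse (real (Suc N2)) < e / 3"
        using reals_Archimedean[OF e3] by blast
      have "snorm (p m - p n) < e" if "m \<ge> max N1 N2" "n \<ge> max N1 N2" for m n
      proof -
        have "inverse (real (Suc m)) \<le> inverse (real (Suc N2))"
          "inverse (real (Suc n)) \<le> inverse (real (Suc N2))"
          using that by auto
        then have "hdist completion (\<sigma> m) (emb (p m)) < e / 3"
          "hdist completion (\<sigma> n) (emb (p n)) < e / 3"
          using p[of m] p[of n] N2 by linarith+
        moreover have "hdist completion (emb (p m)) (emb (p n))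
          \<le> hdist completion (\<sigma> m) (emb (p m)) + hdist completion (\<sigma> m) (\<sigma> n)
            + hdist completion (\<sigma> n) (emb (p n))"
          using M.triangle[of "emb (p m)" "\<sigma> m" "emb (p n)"]
            M.triangle[of "\<sigma> m" "\<sigma> n" "emb (p n)"] M.commute[of "emb (p m)" "\<sigma> m"]
            emb_carrier \<sigma> by (simp del: completion_sel)
        ultimately show ?thesis
          using N1[of m n] that by (simp add: hdist_emb)
      qed
      then show "\<exists>N. \<forall>m\<ge>N. \<forall>n\<ge>N. snorm (p m - p n) < e"
        by blast
    qed
    then obtain a where a: "represents p a"
      by (rule scauchy_represents)
    then have a': "a \<in> carrier completion"
      by auto
    have lim: "(\<lambda>n. inverse (real (Suc n)) + hdist completion a (emb (p n))) \<longlonglongrightarrow> 0"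
      using tendsto_add[OF LIMSEQ_inverse_real_of_nat hdist_emb_tendsto[OF a]] by simp
    have "norm (hdist completion (\<sigma> n) a)
        \<le> inverse (real (Suc n)) + hdist completion a (emb (p n))" for n
      using M.triangle[OF \<sigma>[of n] emb_carrier[of "p n"] a'] p[of n]
        M.commute[of a "emb (p n)"] M.nonneg[of "\<sigma> n" a]
      unfolding real_norm_def by linarith
    then have "(\<lambda>n. hdist completion (\<sigma> n) a) \<longlonglongrightarrow> 0"
      by (intro Lim_null_comparison[OF always_eventually lim] allI)
    then have "limitin M.mtopology \<sigma> a sequentially"
      unfolding M.limitin_metric_dist_null using a \<sigma> by auto
    then show "\<exists>x. limitin M.mtopology \<sigma> x sequentially"
      by blast
  qed
  show "separable_space M.mtopology"
    unfolding separable_space_def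
  proof (intro exI[of _ "emb ` D"] conjI)
    show "countable (emb ` D)"
      using countable_D by simp
    show "emb ` D \<subseteq> topspace M.mtopology"
      using emb_carrier by (auto simp del: completion_sel)
    show "M.mtopology closure_of (emb ` D) = topspace M.mtopology"
    proof
      show "topspace M.mtopology \<subseteq> M.mtopology closure_of (emb ` D)"
      proof
        fix a
        assume "a \<in> topspace M.mtopology"
        then have a: "a \<in> carrier completion"
          by (simp del: completion_sel)
        have "\<exists>b\<in>emb ` D. b \<in> M.mball a r" if "r > 0" for r
        proof -
          obtain v where v: "hdist completion a (emb v) < r / 2"
            using emb_dense[OF a, of "r / 2"] \<open>r > 0\<close> by auto
          obtain i where i: "snorm (v - enum i) < r / 2"
            using enum_dense[of "r / 2" v] \<open>r > 0\<close> by auto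
          have "hdist completion a (emb (enum i)) < r"
            using M.triangle[of a "emb v" "emb (enum i)"] a emb_carrier v i
            by (simp add: hdist_emb del: completion_sel)
          moreover have "enum i \<in> D"
            unfolding enum_def by (rule from_nat_into[OF D_nonempty])
          ultimately show ?thesis
            using a emb_carrier by (auto simp: M.in_mball simp del: completion_sel)
        qed
        then show "a \<in> M.mtopology closure_of (emb ` D)"
          unfolding M.metric_closure_of using a by auto
      qed
    qed (rule closure_of_subset_topspace)
  qed
qed

end

section \<open>Extension of an invertible isometry to the completion\<close>

locale semi_inner_space_isometry = semi_inner_space +
  fixes U :: "'a \<Rightarrow> 'a" and U' :: "'a \<Rightarrow> 'a"
  assumes U_add: "U (x + y) = U x + U y"
    and U_scl: "U (scl c x) = scl c (U x)"
    and U_ip: "ip (U x) (U y) = ip x y"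
    and U_U': "U (U' x) = x"
begin

lemma U_diff: "U (x - y) = U x - U y"
  using U_add[of "x - y" y] by (simp add: algebra_simps)

lemma snorm_U: "snorm (U x) = snorm x"
  by (simp add: snorm_def U_ip)

lemma snorm_U_diff: "snorm (U x - U y) = snorm (x - y)"
  using snorm_U[of "x - y"] by (simp add: U_diff)

definition extension :: "(nat \<Rightarrow> complex) \<Rightarrow> nat \<Rightarrow> complex"
  where "extension a = (THE b. represents (\<lambda>j. U (repr a j)) b)"

lemma scauchy_U: "scauchy (\<lambda>j. U (p j)) \<longleftrightarrow> scauchy p"
  unfolding scauchy_def by (simp add: snorm_U_diff)

text \<open>Since \<open>U\<close> preserves the seminorm, two sequences with the same code have
  images that differ by a null sequence; the choice made in \<open>extension\<close> is therefore
  immaterial.\<close>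

lemma represents_extension:
  assumes "represents p a"
  shows "represents (\<lambda>j. U (p j)) (extension a)"
proof -
  note r = represents_repr[OF assms]
  have "scauchy (\<lambda>j. U (repr a j))"
    using represents_scauchy[OF r] by (simp add: scauchy_U)
  then obtain b where b: "represents (\<lambda>j. U (repr a j)) b"
    by (rule scauchy_represents)
  then have eq: "extension a = b"
    unfolding extension_def using represents_unique by blast
  have null: "(\<lambda>j. snorm (U (p j) - U (repr a j))) \<longlonglongrightarrow> 0"
    using represents_diff_null[OF assms r] by (simp add: snorm_U_diff)
  have "(\<lambda>j. ip (U (p j)) (enum i)) \<longlonglongrightarrow> b i" for i
  proof -
    have "(\<lambda>j. ip (U (p j) - U (repr a j)) (enum i) + ip (U (repr a j)) (enum i)) \<longlonglongrightarrow> 0 + b i"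
      using b unfolding represents_def by (intro tendsto_add ip_tendsto_zero null scauchy_const) auto
    then show ?thesis
      by (simp add: ip_diff_left)
  qed
  then show ?thesis
    using represents_scauchy[OF assms] scauchy_U unfolding eq represents_def by blast
qed

lemma extension_eqI: "represents p a \<Longrightarrow> represents (\<lambda>j. U (p j)) b \<Longrightarrow> extension a = b"
  using represents_extension represents_unique by blast

lemma extension_emb: "extension (emb v) = emb (U v)"
  by (rule extension_eqI[OF represents_emb represents_emb])

text \<open>Injectivity follows from the isometry. For surjectivity, a representative
  \<open>q\<close> of the target is pulled back by \<open>U'\<close>; the pulled back sequence is
  Cauchy because \<open>U\<close> maps it isometrically onto \<open>q\<close>.\<close>

lemma unitary_extension: "unitary_on completion extension"
proof -
  have hip_ext: "hip (extension a) (extension b) = hip a b"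
    if "represents p a" "represents q b" for p q a b
    using that by (intro hip_eqI[OF represents_extension represents_extension])
      (auto simp: U_ip intro: hip_tendsto)
  have add: "extension (\<lambda>i. a i + b i) = (\<lambda>i. extension a i + extension b i)"
    if "represents p a" "represents q b" for p q a b
    using represents_add[OF represents_extension[OF that(1)] represents_extension[OF that(2)]]
    by (intro extension_eqI[OF represents_add[OF that]]) (simp add: U_add)
  have scl: "extension (\<lambda>i. c * a i) = (\<lambda>i. c * extension a i)" if "represents p a" for p a c
    using represents_scl[OF represents_extension[OF that], of c]
    by (intro extension_eqI[OF represents_scl[OF that]]) (simp add: U_scl)
  have inj: "a = b" if "represents p a" "represents q b" "extension a = extension b" for p q a b
  proof -
    have "represents (\<lambda>j. U (p j) - U (q j)) (\<lambda>_. 0)"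
      using represents_diff[OF represents_extension[OF that(1)] represents_extension[OF that(2)]]
        that(3) by simp
    then have "(\<lambda>j. snorm (p j - q j)) \<longlonglongrightarrow> 0"
      using represents_zero_imp_null by (fastforce simp: snorm_U_diff)
    then have "hnorm completion (\<lambda>i. a i - b i) = 0"
      using hip_snorm_tendsto[OF represents_diff[OF that(1,2)]] LIMSEQ_unique by blast
    then show ?thesis
      using hnorm_zero_imp[OF represents_diff[OF that(1,2)]] by (auto simp: fun_eq_iff)
  qed
  have surj: "\<exists>a. (\<exists>p. represents p a) \<and> extension a = b" if "represents q b" for q b
  proof -
    have "scauchy (\<lambda>j. U' (q j))"
      using represents_scauchy[OF that] scauchy_U[of "\<lambda>j. U' (q j)"] by (simp add: U_U')
    then obtain a where a: "represents (\<lambda>j. U' (q j)) a"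
      by (rule scauchy_represents)
    then have "extension a = b"
      using that by (intro extension_eqI[OF a]) (simp add: U_U')
    then show ?thesis
      using a by blast
  qed
  have "bij_betw extension (carrier completion) (carrier completion)"
    unfolding bij_betw_def inj_on_def
    using inj surj represents_extension by (auto simp: image_iff) metis+
  then show ?thesis
    unfolding unitary_on_def using hip_ext add scl by auto
qed

lemma snorm_U_funpow_diff: "snorm ((U ^^ n) x - (U ^^ n) y) = snorm (x - y)"
  by (induction n) (simp_all add: snorm_U_diff)

text \<open>An eigenvector \<open>x\<close> need not be an embedded vector, while mixing is known
  only for those. One far term \<open>p N\<close> of a representative therefore replaces
  \<open>x\<close>, with an error that does not depend on the exponent \<open>n\<close>.\<close>

lemma no_eigenvalue_extension:
  assumes mixing: "\<And>v e. e > 0 \<Longrightarrow> \<exists>n. cmod (ip ((U ^^ n) v) v) < e"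
  shows "\<not> eigenvalue_on completion extension c"
proof
  assume "eigenvalue_on completion extension c"
  then obtain x p where p: "represents p x" and "x \<noteq> (\<lambda>_. 0)"
    and ext: "extension x = (\<lambda>i. c * x i)"
    unfolding eigenvalue_on_def by auto
  define S where "S = (hnorm completion x)\<^sup>2"
  have S: "S > 0" "hip x x = of_real S"
    using hnorm_zero_imp[OF p] \<open>x \<noteq> (\<lambda>_. 0)\<close> hip_self[OF p] by (auto simp: S_def)
  have iter: "represents (\<lambda>j. (U ^^ n) (p j)) (\<lambda>i. c ^ n * x i)" for n
  proof (induction n)
    case (Suc n)
    have "represents (\<lambda>j. U ((U ^^ n) (p j))) (extension (\<lambda>i. c ^ n * x i))"
      by (rule represents_extension[OF Suc])
    moreover have "extension (\<lambda>i. c ^ n * x i) = (\<lambda>i. c ^ n * extension x i)"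
      using unitary_extension p unfolding unitary_on_def completion_sel by blast
    ultimately show ?case
      by (simp add: ext mult_ac)
  qed (use p in simp)
  have lim: "(\<lambda>j. ip ((U ^^ n) (p j)) (p j)) \<longlonglongrightarrow> c ^ n * of_real S" for n
  proof -
    have "hip (\<lambda>i. c ^ n * x i) x = c ^ n * hip x x"
      using hip_eqI[OF represents_scl[OF p] p] hip_tendsto[OF p p]
      by (simp add: ip_scl_left tendsto_mult_left)
    then show ?thesis
      using hip_tendsto[OF iter p, of n] S(2) by simp
  qed
  \<comment> \<open>The seminorms of \<open>U (p j)\<close> tend to the norm of \<open>c\<close>
    times \<open>x\<close> and, \<open>U\<close> being isometric, also to the norm of
    \<open>x\<close>.\<close>
  have "cmod c = 1"
  proof -
    have "(\<lambda>j. snorm (U (p j))) \<longlonglongrightarrow> hnorm completion (\<lambda>i. c * x i)"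
      using hip_snorm_tendsto[OF iter, of 1] by simp
    moreover have "(\<lambda>j. snorm (scl c (p j))) \<longlonglongrightarrow> hnorm completion (\<lambda>i. c * x i)"
      by (rule hip_snorm_tendsto[OF represents_scl[OF p]])
    moreover have "(\<lambda>j. cmod c * snorm (p j)) \<longlonglongrightarrow> cmod c * hnorm completion x"
      by (intro tendsto_mult_left hip_snorm_tendsto p)
    moreover have "(\<lambda>j. snorm (p j)) \<longlonglongrightarrow> hnorm completion x"
      by (rule hip_snorm_tendsto[OF p])
    ultimately have "hnorm completion x = cmod c * hnorm completion x"
      unfolding snorm_U snorm_scl by (metis LIMSEQ_unique)
    then show ?thesis
      using S(1) by (auto simp: S_def)
  qed
  obtain B where B: "B > 0" "\<And>n. snorm (p n) \<le> B"
    using scauchy_bounded[OF represents_scauchy[OF p]] by blast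
  \<comment> \<open>Exchanging \<open>p k\<close> for \<open>p N\<close> in one argument of the form
    costs at most \<open>B * (S / (4 * B)) = S / 4\<close>, so in both at most \<open>S / 2\<close>:
    half of the modulus \<open>S\<close> that the eigenvector provides for every
    \<open>n\<close>.\<close>
  obtain N where N: "\<And>m n. m \<ge> N \<Longrightarrow> n \<ge> N \<Longrightarrow> snorm (p m - p n) < S / (4 * B)"
    using scauchyD[OF represents_scauchy[OF p], of "S / (4 * B)"] S(1) B(1) by auto
  have close: "cmod (ip ((U ^^ n) (p k)) (p k) - ip ((U ^^ n) (p N)) (p N)) \<le> S / 2"
    if "k \<ge> N" for k n
  proof -
    have "snorm ((U ^^ n) (p N)) = snorm (p N)"
      by (induction n) (simp_all add: snorm_U)
    then have "cmod (ip ((U ^^ n) (p N)) (p k - p N)) \<le> B * (S / (4 * B))"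
      using N[OF that order_refl] B(2)[of N] B(1)
      by (intro order_trans[OF Cauchy_Schwarz] mult_mono) auto
    moreover have "cmod (ip ((U ^^ n) (p k) - (U ^^ n) (p N)) (p k)) \<le> (S / (4 * B)) * B"
      using N[OF that order_refl] B(2)[of k] B(1) S(1)
      by (intro order_trans[OF Cauchy_Schwarz] mult_mono) (auto simp: snorm_U_funpow_diff)
    moreover have "ip ((U ^^ n) (p k)) (p k) - ip ((U ^^ n) (p N)) (p N)
        = ip ((U ^^ n) (p k) - (U ^^ n) (p N)) (p k) + ip ((U ^^ n) (p N)) (p k - p N)"
      by (simp add: ip_diff_left ip_diff_right)
    ultimately show ?thesis
      using B(1) norm_triangle_ineq[of "ip ((U ^^ n) (p k) - (U ^^ n) (p N)) (p k)"
        "ip ((U ^^ n) (p N)) (p k - p N)"] by (simp add: field_simps)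
  qed
  obtain n where n: "cmod (ip ((U ^^ n) (p N)) (p N)) < S / 2"
    using mixing[of "S / 2" "p N"] S(1) by auto
  \<comment> \<open>This is the limit of \<open>close\<close> as \<open>k\<close> tends to
    infinity.\<close>
  have "cmod (c ^ n * of_real S - ip ((U ^^ n) (p N)) (p N)) \<le> S / 2"
    by (rule LIMSEQ_le_const2[OF tendsto_norm[OF tendsto_diff[OF lim tendsto_const]]])
      (use close in auto)
  moreover have "cmod (c ^ n * of_real S) = S"
    using S(1) \<open>cmod c = 1\<close> by (simp add: norm_mult norm_power)
  ultimately show False
    using n norm_triangle_sub[of "c ^ n * of_real S" "ip ((U ^^ n) (p N)) (p N)"] by simp
qed

text \<open>A single space, operator and unit vector bound the infimum. The exponents in
  \<open>Q\<close> are nonnegative, so \<open>op_powi\<close> is a plain iterate of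
  \<open>extension\<close>, which acts on embedded vectors as \<open>U\<close> does.\<close>

lemma modified_Kazhdan_constant_le:
  assumes mixing: "\<And>v e. e > 0 \<Longrightarrow> \<exists>n. cmod (ip ((U ^^ n) v) v) < e"
    and "snorm x = 1" and Q: "\<And>q. q \<in> Q \<Longrightarrow> 0 \<le> q"
  shows "modified_Kazhdan_constant Q \<le> (SUP q\<in>Q. ennreal (snorm ((U ^^ nat q) x - x)))"
proof -
  have pow: "(extension ^^ n) (emb x) = emb ((U ^^ n) x)" for n
    by (induction n) (simp_all add: extension_emb)
  have eq: "hnorm completion (op_powi completion extension q (emb x) \<ominus>\<^bsub>completion\<^esub> emb x)
      = snorm ((U ^^ nat q) x - x)" if "q \<in> Q" for q
    using Q[OF that] by (simp add: op_powi_def pow a_minus_completion hnorm_emb_diff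
        del: completion_sel)
  have "(completion, extension) \<in> eigenvalue_free_unitaries"
    unfolding eigenvalue_free_unitaries_def
    using separable_hilbert_space_completion unitary_extension no_eigenvalue_extension[OF mixing]
    by simp
  moreover have "emb x \<in> {x \<in> carrier completion. hnorm completion x = 1}"
    using emb_carrier \<open>snorm x = 1\<close> by (simp add: hnorm_emb del: completion_sel)
  ultimately have "modified_Kazhdan_constant Q \<le> (SUP q\<in>Q. ennreal
      (hnorm completion (op_powi completion extension q (emb x) \<ominus>\<^bsub>completion\<^esub> emb x)))"
    unfolding modified_Kazhdan_constant_def
    by (intro INF_lower2[of "(completion, extension)"]) (auto intro: INF_lower2)
  then show ?thesis
    by (simp add: eq cong: SUP_cong)
qed

end

section \<open>Measures on the circle\<close>

lemma
  assumes "circle_prob_measure \<mu>"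
  shows circle_prob_space: "prob_space \<mu>"
    and circle_sets: "sets \<mu> = sets circle_borel"
    and circle_space: "space \<mu> = sphere 0 1"
proof -
  show "prob_space \<mu>" and sets: "sets \<mu> = sets circle_borel"
    using assms by (auto simp: circle_prob_measure_def)
  show "space \<mu> = sphere 0 1"
    using sets_eq_imp_space_eq[OF sets] by (simp add: circle_borel_def space_restrict_space)
qed

text \<open>Continuity is asked for on the circle only because \<open>z powi n\<close> with
  \<open>n < 0\<close> is discontinuous at 0.\<close>

lemma circle_measurable_continuous:
  fixes f :: "complex \<Rightarrow> 'a::topological_space"
  assumes "circle_prob_measure \<mu>" "continuous_on (sphere 0 1) f"
  shows "f \<in> borel_measurable \<mu>"
  using borel_measurable_continuous_on_restrict[OF assms(2)]
  by (subst measurable_cong_sets[OF circle_sets[OF assms(1)] refl]) (simp add: circle_borel_def)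

lemma circle_integrable_continuous:
  fixes f :: "complex \<Rightarrow> complex"
  assumes "circle_prob_measure \<mu>" "continuous_on (sphere 0 1) f"
  shows "integrable \<mu> f"
proof -
  interpret prob_space \<mu>
    by (rule circle_prob_space[OF assms(1)])
  have "bounded (f ` sphere 0 1)"
    by (intro compact_imp_bounded compact_continuous_image assms compact_sphere)
  then obtain B where "\<And>z. z \<in> sphere 0 1 \<Longrightarrow> norm (f z) \<le> B"
    unfolding bounded_iff by blast
  then show ?thesis
    using circle_measurable_continuous[OF assms] circle_space[OF assms(1)]
    by (intro integrable_const_bound[of f B]) auto
qed

lemma continuous_on_circle_powi: "continuous_on (sphere 0 1) (\<lambda>z::complex. z powi n)"
  by (intro continuous_intros) auto

lemma circle_prob_measure_distr:
  assumes "prob_space M" "f \<in> borel_measurable M" "\<And>x. x \<in> space M \<Longrightarrow> norm (f x) = 1"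
  shows "circle_prob_measure (distr M circle_borel f)"
    and "f \<in> M \<rightarrow>\<^sub>M circle_borel"
proof -
  show f: "f \<in> M \<rightarrow>\<^sub>M circle_borel"
    unfolding circle_borel_def using assms(2,3) by (intro measurable_restrict_space2) auto
  show "circle_prob_measure (distr M circle_borel f)"
    unfolding circle_prob_measure_def using prob_space.prob_space_distr[OF assms(1) f] by simp
qed

lemma circle_borel_singleton: "norm z = 1 \<Longrightarrow> {z} \<in> sets circle_borel"
  unfolding circle_borel_def by (auto simp: sets_restrict_space image_iff intro!: bexI[of _ "{z}"])

lemma circle_borel_powi: "(\<lambda>z. z powi n) \<in> borel_measurable circle_borel"
  unfolding circle_borel_def
  by (rule borel_measurable_continuous_on_restrict[OF continuous_on_circle_powi])

lemma fourier_coeff_distr: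
  assumes "f \<in> M \<rightarrow>\<^sub>M circle_borel"
  shows "fourier_coeff (distr M circle_borel f) n = (\<integral>x. f x powi n \<partial>M)"
  unfolding fourier_coeff_def by (rule integral_distr[OF assms circle_borel_powi])

lemma continuous_measureD:
  assumes "circle_prob_measure \<mu>" "continuous_measure \<mu>"
  shows "emeasure \<mu> {z} = 0"
proof (cases "z \<in> sphere 0 1")
  case True
  interpret prob_space \<mu>
    by (rule circle_prob_space[OF assms(1)])
  show ?thesis
    using assms(2) True unfolding continuous_measure_def by (simp add: emeasure_eq_measure)
next
  \<comment> \<open>Off the circle \<open>{z}\<close> is not a measurable set, and
    \<open>emeasure\<close> is 0 there by convention.\<close>
  case False
  then show ?thesis
    using circle_space[OF assms(1)] sets.sets_into_space[of "{z}" \<mu>]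
    by (intro emeasure_notin_sets) auto
qed

section \<open>Quotients of independent points, symmetrization and averages\<close>

lemma circle_quotient_measurable:
  assumes "circle_prob_measure \<mu>"
  shows "(\<lambda>w. fst w * cnj (snd w)) \<in> borel_measurable (\<mu> \<Otimes>\<^sub>M \<mu>)"
  by (rule borel_measurable_times measurable_compose[OF measurable_fst]
      measurable_compose[OF measurable_snd] circle_measurable_continuous[OF assms]
      continuous_on_id continuous_on_cnj)+

text \<open>By Fubini: for fixed \<open>x\<close> only the point \<open>cnj z * x\<close> can occur
  as second coordinate. This yields the continuity of the symmetrized measure and, for
  \<open>z = 1\<close>, the null diagonal in Wiener's lemma.\<close>

lemma circle_quotient_null:
  assumes \<mu>: "circle_prob_measure \<mu>" and cont: "continuous_measure \<mu>" and z: "norm z = 1"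
  shows "emeasure (\<mu> \<Otimes>\<^sub>M \<mu>) {w \<in> space (\<mu> \<Otimes>\<^sub>M \<mu>). fst w * cnj (snd w) = z} = 0"
proof -
  interpret prob_space \<mu>
    by (rule circle_prob_space[OF \<mu>])
  note [measurable] = circle_quotient_measurable[OF \<mu>]
  define A where "A = {w \<in> space (\<mu> \<Otimes>\<^sub>M \<mu>). fst w * cnj (snd w) = z}"
  have "A \<in> sets (\<mu> \<Otimes>\<^sub>M \<mu>)"
    unfolding A_def by measurable
  then have "emeasure (\<mu> \<Otimes>\<^sub>M \<mu>) A = (\<integral>\<^sup>+x. emeasure \<mu> (Pair x -` A) \<partial>\<mu>)"
    by (rule emeasure_pair_measure_alt)
  also have "\<dots> = (\<integral>\<^sup>+x. 0 \<partial>\<mu>)"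
  proof (rule nn_integral_cong)
    fix x
    assume "x \<in> space \<mu>"
    have "y = cnj z * x" if "x * cnj y = z" "cmod x = 1" for y
    proof -
      have "cnj z * x = y * (x * cnj x)"
        by (simp flip: that(1) add: mult_ac)
      then show ?thesis
        using that(2) by (simp flip: complex_norm_square)
    qed
    then have "Pair x -` A \<subseteq> {cnj z * x}"
      by (auto simp: A_def space_pair_measure circle_space[OF \<mu>])
    moreover have "{cnj z * x} \<in> sets \<mu>"
      using z \<open>x \<in> space \<mu>\<close> circle_space[OF \<mu>]
      by (auto simp: circle_sets[OF \<mu>] norm_mult intro!: circle_borel_singleton)
    ultimately show "emeasure \<mu> (Pair x -` A) = 0"
      using emeasure_mono[of _ "{cnj z * x}" \<mu>] continuous_measureD[OF \<mu> cont]
      by (metis le_zero_eq)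
  qed
  finally show ?thesis
    by (simp add: A_def)
qed

text \<open>The law of \<open>x * cnj y\<close> for independent \<open>x\<close>, \<open>y\<close>
  with law \<mu>, that is, the convolution of \<mu> with its conjugate. Independence factors its
  coefficients into those of \<mu> and their conjugates.\<close>

lemma circle_symmetrization:
  assumes \<mu>: "circle_prob_measure \<mu>" and cont: "continuous_measure \<mu>"
  obtains \<nu> where "circle_prob_measure \<nu>" "continuous_measure \<nu>"
    "\<And>n. fourier_coeff \<nu> n = of_real ((cmod (fourier_coeff \<mu> n))\<^sup>2)"
proof -
  interpret prob_space \<mu>
    by (rule circle_prob_space[OF \<mu>])
  interpret P: pair_prob_space \<mu> \<mu> ..
  define f :: "complex \<times> complex \<Rightarrow> complex" where "f = (\<lambda>w. fst w * cnj (snd w))"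
  have space: "space (\<mu> \<Otimes>\<^sub>M \<mu>) = sphere 0 1 \<times> sphere 0 1"
    by (simp add: space_pair_measure circle_space[OF \<mu>])
  have meas: "f \<in> borel_measurable (\<mu> \<Otimes>\<^sub>M \<mu>)"
    unfolding f_def by (rule circle_quotient_measurable[OF \<mu>])
  have norm: "norm (f w) = 1" if "w \<in> space (\<mu> \<Otimes>\<^sub>M \<mu>)" for w
    using that by (auto simp: space f_def norm_mult)
  note circ = circle_prob_measure_distr[OF P.prob_space_axioms meas norm]
  define \<nu> where "\<nu> = distr (\<mu> \<Otimes>\<^sub>M \<mu>) circle_borel f"
  show ?thesis
  proof
    show "circle_prob_measure \<nu>"
      unfolding \<nu>_def by (rule circ)
    show "continuous_measure \<nu>"
      unfolding continuous_measure_def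
    proof
      fix z :: complex
      assume "z \<in> sphere 0 1"
      then have z: "norm z = 1"
        by simp
      have "emeasure \<nu> {z} = emeasure (\<mu> \<Otimes>\<^sub>M \<mu>) (f -` {z} \<inter> space (\<mu> \<Otimes>\<^sub>M \<mu>))"
        unfolding \<nu>_def by (intro emeasure_distr[OF circ(2)] circle_borel_singleton z)
      also have "f -` {z} \<inter> space (\<mu> \<Otimes>\<^sub>M \<mu>) = {w \<in> space (\<mu> \<Otimes>\<^sub>M \<mu>). fst w * cnj (snd w) = z}"
        by (auto simp: f_def)
      also have "emeasure (\<mu> \<Otimes>\<^sub>M \<mu>) \<dots> = 0"
        by (rule circle_quotient_null[OF \<mu> cont z])
      finally show "measure \<nu> {z} = 0"
        by (simp add: measure_def)
    qed
    fix n
    have powi: "(\<lambda>z. z powi n) \<in> borel_measurable \<mu>"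
      by (rule circle_measurable_continuous[OF \<mu> continuous_on_circle_powi])
    have [measurable]: "(\<lambda>w. fst w powi n) \<in> borel_measurable (\<mu> \<Otimes>\<^sub>M \<mu>)"
      "(\<lambda>w. cnj (snd w powi n)) \<in> borel_measurable (\<mu> \<Otimes>\<^sub>M \<mu>)"
      by (rule measurable_compose[OF measurable_fst powi] measurable_compose[OF measurable_snd]
          circle_measurable_continuous[OF \<mu>] continuous_on_cnj continuous_on_circle_powi)+
    have int: "integrable (\<mu> \<Otimes>\<^sub>M \<mu>) (\<lambda>(x, y). x powi n * cnj (y powi n))"
      unfolding case_prod_beta by (intro P.integrable_const_bound[of _ 1])
        (auto simp del: complex_cnj_power_int simp: space norm_mult norm_power_int intro!: AE_I2)
    have "fourier_coeff \<nu> n = (\<integral>w. f w powi n \<partial>(\<mu> \<Otimes>\<^sub>M \<mu>))"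
      unfolding \<nu>_def by (rule fourier_coeff_distr[OF circ(2)])
    also have "\<dots> = (\<integral>w. (case w of (x, y) \<Rightarrow> x powi n * cnj (y powi n)) \<partial>(\<mu> \<Otimes>\<^sub>M \<mu>))"
      by (simp add: f_def case_prod_beta power_int_mult_distrib complex_cnj_power_int)
    also have "\<dots> = (\<integral>x. \<integral>y. x powi n * cnj (y powi n) \<partial>\<mu> \<partial>\<mu>)"
      using P.integral_fst'[OF int] by simp
    also have "\<dots> = fourier_coeff \<mu> n * cnj (fourier_coeff \<mu> n)"
      by (simp add: fourier_coeff_def del: complex_cnj_power_int)
    finally show "fourier_coeff \<nu> n = of_real ((cmod (fourier_coeff \<mu> n))\<^sup>2)"
      by (simp only: complex_norm_square)
  qed
qed

text \<open>A fair coin selects one of two independent points with laws \<mu> and \<nu>. Presenting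
  the average as the image of a product of probability spaces reduces everything to transfer along
  \<open>distr\<close> and Fubini.\<close>

lemma circle_mixture:
  assumes \<mu>: "circle_prob_measure \<mu>" "continuous_measure \<mu>"
    and \<nu>: "circle_prob_measure \<nu>" "continuous_measure \<nu>"
  obtains \<rho> where "circle_prob_measure \<rho>" "continuous_measure \<rho>"
    "\<And>n. fourier_coeff \<rho> n = (fourier_coeff \<mu> n + fourier_coeff \<nu> n) / 2"
proof -
  interpret M: prob_space \<mu>
    by (rule circle_prob_space[OF \<mu>(1)])
  interpret N: prob_space \<nu>
    by (rule circle_prob_space[OF \<nu>(1)])
  interpret P: pair_prob_space \<mu> \<nu> ..
  define coin where "coin = measure_pmf (pmf_of_set (UNIV :: bool set))"
  interpret C: prob_space coin
    unfolding coin_def by (rule prob_space_measure_pmf)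
  interpret Q: pair_prob_space coin "\<mu> \<Otimes>\<^sub>M \<nu>" ..
  have [measurable]: "fst \<in> borel_measurable (\<mu> \<Otimes>\<^sub>M \<nu>)" "snd \<in> borel_measurable (\<mu> \<Otimes>\<^sub>M \<nu>)"
    using measurable_compose[OF measurable_fst circle_measurable_continuous[OF \<mu>(1) continuous_on_id]]
      measurable_compose[OF measurable_snd circle_measurable_continuous[OF \<nu>(1) continuous_on_id]]
    by auto
  define f where "f = (\<lambda>(b, x, y). if b then x else y :: complex)"
  have [measurable]: "Measurable.pred coin (\<lambda>b. b)"
    by (simp add: coin_def)
  have space: "space (coin \<Otimes>\<^sub>M (\<mu> \<Otimes>\<^sub>M \<nu>)) = UNIV \<times> sphere 0 1 \<times> sphere 0 1"
    by (simp add: space_pair_measure circle_space[OF \<mu>(1)] circle_space[OF \<nu>(1)] coin_def)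
  have meas: "f \<in> borel_measurable (coin \<Otimes>\<^sub>M (\<mu> \<Otimes>\<^sub>M \<nu>))"
    unfolding f_def by measurable
  have norm: "norm (f w) = 1" if "w \<in> space (coin \<Otimes>\<^sub>M (\<mu> \<Otimes>\<^sub>M \<nu>))" for w
    using that by (auto simp: space f_def)
  note circ = circle_prob_measure_distr[OF Q.prob_space_axioms meas norm]
  define \<rho> where "\<rho> = distr (coin \<Otimes>\<^sub>M (\<mu> \<Otimes>\<^sub>M \<nu>)) circle_borel f"
  show ?thesis
  proof
    show "circle_prob_measure \<rho>"
      unfolding \<rho>_def by (rule circ)
    show "continuous_measure \<rho>"
      unfolding continuous_measure_def
    proof
      fix z :: complex
      assume z: "z \<in> sphere 0 1"
      then have sing: "{z} \<in> sets circle_borel"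
        by (intro circle_borel_singleton) simp
      have sing': "{z} \<in> sets \<mu>" "{z} \<in> sets \<nu>"
        using sing by (simp_all add: circle_sets[OF \<mu>(1)] circle_sets[OF \<nu>(1)])
      have null: "emeasure (\<mu> \<Otimes>\<^sub>M \<nu>) ({z} \<times> space \<nu>) = 0" "emeasure (\<mu> \<Otimes>\<^sub>M \<nu>) (space \<mu> \<times> {z}) = 0"
        using sing' continuous_measureD[OF \<mu>] continuous_measureD[OF \<nu>]
        by (simp_all add: N.emeasure_pair_measure_Times)
      have A: "f -` {z} \<inter> space (coin \<Otimes>\<^sub>M (\<mu> \<Otimes>\<^sub>M \<nu>)) \<in> sets (coin \<Otimes>\<^sub>M (\<mu> \<Otimes>\<^sub>M \<nu>))"
        by (rule measurable_sets[OF circ(2) sing])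
      have "emeasure \<rho> {z}
          = emeasure (coin \<Otimes>\<^sub>M (\<mu> \<Otimes>\<^sub>M \<nu>)) (f -` {z} \<inter> space (coin \<Otimes>\<^sub>M (\<mu> \<Otimes>\<^sub>M \<nu>)))"
        unfolding \<rho>_def by (rule emeasure_distr[OF circ(2) sing])
      also have "\<dots> = (\<integral>\<^sup>+b. emeasure (\<mu> \<Otimes>\<^sub>M \<nu>)
          (Pair b -` (f -` {z} \<inter> space (coin \<Otimes>\<^sub>M (\<mu> \<Otimes>\<^sub>M \<nu>)))) \<partial>coin)"
        by (rule P.emeasure_pair_measure_alt[OF A])
      also have "\<dots> = (\<integral>\<^sup>+b. 0 \<partial>coin)"
      proof (rule nn_integral_cong)
        fix b :: bool
        have "Pair b -` (f -` {z} \<inter> space (coin \<Otimes>\<^sub>M (\<mu> \<Otimes>\<^sub>M \<nu>)))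
            = (if b then {z} \<times> space \<nu> else space \<mu> \<times> {z})"
          using z by (auto simp: space f_def circle_space[OF \<mu>(1)] circle_space[OF \<nu>(1)])
        then show "emeasure (\<mu> \<Otimes>\<^sub>M \<nu>) (Pair b -` (f -` {z} \<inter> space (coin \<Otimes>\<^sub>M (\<mu> \<Otimes>\<^sub>M \<nu>)))) = 0"
          using null by simp
      qed
      finally show "measure \<rho> {z} = 0"
        by (simp add: measure_def)
    qed
    fix n
    have powi [measurable]: "(\<lambda>z. z powi n) \<in> borel_measurable \<mu>" "(\<lambda>z. z powi n) \<in> borel_measurable \<nu>"
      by (rule circle_measurable_continuous[OF _ continuous_on_circle_powi], fact)+
    have bound: "norm (x powi n) \<le> 1" if "x \<in> sphere 0 1" for x :: complex
      using that by (simp add: norm_power_int)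
    have "(\<lambda>w. f w powi n) \<in> borel_measurable (coin \<Otimes>\<^sub>M (\<mu> \<Otimes>\<^sub>M \<nu>))"
      by (rule measurable_compose[OF circ(2) circle_borel_powi])
    then have int: "integrable (coin \<Otimes>\<^sub>M (\<mu> \<Otimes>\<^sub>M \<nu>)) (\<lambda>w. f w powi n)"
      using norm by (intro Q.integrable_const_bound[of _ 1]) (auto simp: norm_power_int intro!: AE_I2)
    have 1: "integrable (\<mu> \<Otimes>\<^sub>M \<nu>) (\<lambda>w. fst w powi n)"
      by (intro P.integrable_const_bound[of _ 1])
        (auto simp: space_pair_measure circle_space[OF \<mu>(1)] norm_power_int intro!: AE_I2)
    have 2: "integrable (\<mu> \<Otimes>\<^sub>M \<nu>) (\<lambda>w. snd w powi n)"
      by (intro P.integrable_const_bound[of _ 1])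
        (auto simp: space_pair_measure circle_space[OF \<nu>(1)] norm_power_int intro!: AE_I2)
    have "fourier_coeff \<rho> n = (\<integral>w. f w powi n \<partial>(coin \<Otimes>\<^sub>M (\<mu> \<Otimes>\<^sub>M \<nu>)))"
      unfolding \<rho>_def by (rule fourier_coeff_distr[OF circ(2)])
    also have "\<dots> = (\<integral>b. \<integral>w. f (b, w) powi n \<partial>(\<mu> \<Otimes>\<^sub>M \<nu>) \<partial>coin)"
      by (rule Q.integral_fst'[OF int, symmetric])
    also have "\<dots> = (\<Sum>b\<in>UNIV. (1 / 2) *\<^sub>R (\<integral>w. f (b, w) powi n \<partial>(\<mu> \<Otimes>\<^sub>M \<nu>)))"
      unfolding coin_def by (subst integral_measure_pmf[of UNIV]) auto
    also have "\<dots> = ((\<integral>w. fst w powi n \<partial>(\<mu> \<Otimes>\<^sub>M \<nu>)) + (\<integral>w. snd w powi n \<partial>(\<mu> \<Otimes>\<^sub>M \<nu>))) / 2"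
      by (simp add: UNIV_bool f_def case_prod_beta scaleR_conv_of_real)
    also have "(\<integral>w. fst w powi n \<partial>(\<mu> \<Otimes>\<^sub>M \<nu>)) = fourier_coeff \<mu> n"
      using P.integral_fst'[OF 1] by (simp add: fourier_coeff_def N.prob_space)
    also have "(\<integral>w. snd w powi n \<partial>(\<mu> \<Otimes>\<^sub>M \<nu>)) = fourier_coeff \<nu> n"
      using P.integral_fst'[OF 2] by (simp add: fourier_coeff_def M.prob_space)
    finally show "fourier_coeff \<rho> n = (fourier_coeff \<mu> n + fourier_coeff \<nu> n) / 2" .
  qed
qed

section \<open>Sparse angles and the circle points they select\<close>

lemma cos_ge_one_minus_abs: "1 - \<bar>x\<bar> \<le> cos (x::real)"
proof -
  have "cos x = 1 - 2 * (sin (x / 2))\<^sup>2"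
    using cos_double_sin[of "x / 2"] by simp
  moreover have "(sin (x / 2))\<^sup>2 \<le> \<bar>x / 2\<bar>"
  proof -
    have "\<bar>sin (x / 2)\<bar> * \<bar>sin (x / 2)\<bar> \<le> \<bar>x / 2\<bar> * 1"
      by (intro mult_mono abs_sin_x_le_abs_x abs_sin_le_one) auto
    then show ?thesis
      by (simp add: power2_eq_square)
  qed
  ultimately show ?thesis
    by simp
qed

text \<open>The orders of the roots are powers of \<open>b\<close>, and \<open>c\<close> is the
  other base; the pairs used are (2, 3) and (3, 2). The parameter \<open>C\<close> delays the start
  of the sequence, which makes the error in \<open>point_power_close\<close> as small as
  desired.\<close>

locale lacunary_angles =
  fixes b c C :: nat
  assumes b: "2 \<le> b" and C: "1 \<le> C" and c: "1 \<le> c" and bc: "b * c \<le> 6"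
begin

text \<open>The ratio 4 comes from \<open>6 < 16 = 2 ^ 4\<close>: numbers up to
  \<open>6 ^ e j\<close> are negligible against \<open>b ^ e (Suc j)\<close>, which is at least
  \<open>16 ^ e j\<close>.\<close>

definition e :: "nat \<Rightarrow> nat"
  where "e j = 4 ^ (j + C)"

definition w :: "nat \<Rightarrow> real"
  where "w j = 1 / real b ^ e j"

definition angle :: "(nat \<Rightarrow> bool) \<Rightarrow> real"
  where "angle \<omega> = suminf (\<lambda>j. of_bool (\<omega> j) * w j)"

definition tail :: "nat \<Rightarrow> (nat \<Rightarrow> bool) \<Rightarrow> real"
  where "tail j \<omega> = suminf (\<lambda>i. of_bool (\<omega> (i + j)) * w (i + j))"

lemma e_Suc: "e (Suc j) = 4 * e j"
  by (simp add: e_def)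

lemma e_add: "e j + i \<le> e (i + j)"
proof -
  have "e j + i \<le> e j * (1 + i)"
    by (simp add: e_def)
  moreover have "1 + i \<le> 4 ^ i"
    by (induction i) auto
  ultimately have "e j + i \<le> e j * 4 ^ i"
    by (meson le_trans mult_le_mono2)
  also have "\<dots> = e (i + j)"
    by (simp add: e_def power_add mult_ac)
  finally show ?thesis .
qed

lemma w_pos: "0 < w j"
  using b by (simp add: w_def)

lemma w_shift: "w (i + j) \<le> w j * (1 / 2) ^ i"
proof -
  have "real b ^ e j * 2 ^ i \<le> real b ^ e j * real b ^ i"
    using b by (intro mult_left_mono power_mono) auto
  also have "\<dots> \<le> real b ^ e (i + j)"
    using b e_add[of j i] by (auto simp flip: power_add intro!: power_increasing)
  finally show ?thesis
    using b by (simp add: w_def power_one_over divide_simps)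
qed

lemma
  shows tail_summable: "summable (\<lambda>i. of_bool (\<omega> (i + j)) * w (i + j))"
    and tail_nonneg: "0 \<le> tail j \<omega>"
    and tail_le: "tail j \<omega> \<le> 2 * w j"
proof -
  have le: "of_bool (\<omega> (i + j)) * w (i + j) \<le> w j * (1 / 2) ^ i" for i
    using w_shift[of i j] w_pos[of j] by (auto simp: of_bool_def intro: less_imp_le)
  have sums: "(\<lambda>i. w j * (1 / 2) ^ i) sums (w j * 2)"
    using sums_mult[OF geometric_sums[of "1 / 2 :: real"], of "w j"] by simp
  show summable: "summable (\<lambda>i. of_bool (\<omega> (i + j)) * w (i + j))"
    using le w_pos by (intro summable_comparison_test'[OF sums_summable[OF sums], of 0])
      (auto simp: abs_mult abs_of_pos)
  show "0 \<le> tail j \<omega>"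
    unfolding tail_def using w_pos by (intro suminf_nonneg summable) (auto intro: less_imp_le)
  show "tail j \<omega> \<le> 2 * w j"
    unfolding tail_def using suminf_le[OF le summable sums_summable[OF sums]] sums_unique[OF sums]
    by simp
qed

lemma angle_split: "angle \<omega> = tail j \<omega> + (\<Sum>i<j. of_bool (\<omega> i) * w i)"
  unfolding angle_def tail_def
  using suminf_split_initial_segment[OF tail_summable[of \<omega> 0, unfolded add_0_right]] .

lemma w_le: "w j \<le> 1 / 16"
proof -
  have "(16::real) = 2 ^ 4"
    by simp
  also have "\<dots> \<le> 2 ^ e j"
    using C self_le_power[of 4 "j + C"] by (intro power_increasing) (auto simp: e_def)
  also have "\<dots> \<le> real b ^ e j"
    using b by (intro power_mono) auto
  finally show ?thesis
    by (simp add: w_def divide_simps)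
qed

text \<open>Together with \<open>tail_le\<close>, each weight exceeds the sum of all later ones.
  Angles are therefore ordered like their coin sequences lexicographically, which gives
  injectivity.\<close>

lemma w_Suc: "2 * w (Suc j) < w j"
proof -
  have "w (Suc j) = w j * w j * w j * w j"
    by (simp add: w_def e_Suc power_mult power4_eq_xxxx power_mult_distrib mult.commute[of 4]
        power_divide)
  also have "\<dots> \<le> w j * (1 / 16) * (1/16) * (1/16)"
    using w_le[of j] w_pos[of j] by (intro mult_mono) auto
  finally show ?thesis
    using w_pos[of j] by simp
qed

lemma angle_less:
  assumes "\<omega> j" "\<not> \<omega>' j" "\<And>i. i < j \<Longrightarrow> \<omega> i = \<omega>' i"
  shows "angle \<omega>' < angle \<omega>"
proof -
  have "tail (Suc j) \<omega>' < w j + tail (Suc j) \<omega>"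
    using tail_le[of "Suc j" \<omega>'] w_Suc[of j] tail_nonneg[of "Suc j" \<omega>] by simp
  moreover have "(\<Sum>i<j. of_bool (\<omega> i) * w i) = (\<Sum>i<j. of_bool (\<omega>' i) * w i)"
    using assms(3) by (intro sum.cong) auto
  ultimately show ?thesis
    using assms(1,2) by (simp add: angle_split[of _ "Suc j"])
qed

lemma inj_angle: "inj angle"
proof (rule injI, rule ccontr)
  fix \<omega> \<omega>'
  assume "angle \<omega> = angle \<omega>'" "\<omega> \<noteq> \<omega>'"
  define j where "j = (LEAST j. \<omega> j \<noteq> \<omega>' j)"
  obtain i where "\<omega> i \<noteq> \<omega>' i"
    using \<open>\<omega> \<noteq> \<omega>'\<close> by blast
  then have "\<omega> j \<noteq> \<omega>' j"
    unfolding j_def by (rule LeastI)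
  moreover have "\<omega> i = \<omega>' i" if "i < j" for i
    using not_less_Least that unfolding j_def by blast
  ultimately show False
    using angle_less[of \<omega> j \<omega>'] angle_less[of \<omega>' j \<omega>] \<open>angle \<omega> = angle \<omega>'\<close> by auto
qed

definition point :: "(nat \<Rightarrow> bool) \<Rightarrow> complex"
  where "point \<omega> = cis (2 * pi * angle \<omega>)"

lemma angle_bounds: "0 \<le> angle \<omega>" "angle \<omega> \<le> 1 / 8"
  using tail_nonneg[of 0 \<omega>] tail_le[of 0 \<omega>] w_le[of 0] by (simp_all add: angle_split[of _ 0])

text \<open>All angles lie within an eighth of a turn, so nothing wraps around and the sine alone
  determines the angle. Injectivity reduces the continuity of the law of \<open>point\<close> to
  single coin sequences having probability 0.\<close>

lemma inj_point: "inj point"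
proof (rule injI)
  fix \<omega> \<omega>'
  assume "point \<omega> = point \<omega>'"
  then have eq: "sin (2 * pi * angle \<omega>) = sin (2 * pi * angle \<omega>')"
    by (simp add: point_def complex_eq_iff)
  have range: "- (pi / 2) \<le> 2 * pi * angle \<omega>" "2 * pi * angle \<omega> \<le> pi / 2" for \<omega>
  proof -
    have "- (pi / 2) \<le> 0" "0 \<le> 2 * pi * angle \<omega>"
      using angle_bounds(1)[of \<omega>] by simp_all
    then show "- (pi / 2) \<le> 2 * pi * angle \<omega>"
      by (rule order_trans)
    show "2 * pi * angle \<omega> \<le> pi / 2"
      using angle_bounds(2)[of \<omega>] mult_left_mono[of "angle \<omega>" "1 / 4" "2 * pi"] by simp
  qed
  have "2 * pi * angle \<omega> = 2 * pi * angle \<omega>'"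
    by (rule sin_inj_pi[OF range range eq])
  then show "\<omega> = \<omega>'"
    using inj_angle by (auto simp: inj_eq)
qed

text \<open>
  The terms before the \<open>j\<close>-th contribute integers to \<open>n * angle \<omega>\<close>, the later ones are
  negligible; only the coin \<open>\<omega> j\<close> can move \<open>point \<omega> ^ n\<close> away from 1.
\<close>

lemma point_power_close:
  assumes "k' \<le> k" "\<And>i. i < j \<Longrightarrow> e i \<le> k" "k < e j" "\<not> \<omega> j"
  shows "1 - 4 * pi * (1 / 2) ^ C \<le> Re (point \<omega> ^ (b ^ k * c ^ k'))"
proof -
  define n where "n = b ^ k * c ^ k'"
  have "of_bool (\<omega> i) * (real n * w i) \<in> \<int>" if "i < j" for i
  proof -
    have "real b ^ k = real b ^ (k - e i) * real b ^ e i"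
      using assms(2)[OF that] by (simp flip: power_add)
    then have "real n * w i = real (b ^ (k - e i) * c ^ k')"
      using b by (simp add: n_def w_def)
    then show ?thesis
      by (metis Ints_mult Ints_of_nat of_nat_of_bool)
  qed
  then have int: "(\<Sum>i<j. of_bool (\<omega> i) * (real n * w i)) \<in> \<int>"
    by (intro Ints_sum) auto
  \<comment> \<open>As coin \<open>j\<close> shows tails, the remainder starts at
    \<open>Suc j\<close>, where the weights are already small compared with
    \<open>1 / n\<close>.\<close>
  have "angle \<omega> = tail (Suc j) \<omega> + (\<Sum>i<j. of_bool (\<omega> i) * w i)"
    using assms(4) by (simp add: angle_split[of _ "Suc j"])
  moreover have "(\<Sum>i<j. of_bool (\<omega> i) * (real n * w i)) = real n * (\<Sum>i<j. of_bool (\<omega> i) * w i)"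
    by (simp only: sum_distrib_left mult.left_commute)
  ultimately have "real n * (2 * pi * angle \<omega>) = 2 * pi * (real n * tail (Suc j) \<omega>)
      + 2 * pi * (\<Sum>i<j. of_bool (\<omega> i) * (real n * w i))"
    by (simp only: distrib_left mult_ac)
  then have "cis (real n * (2 * pi * angle \<omega>)) = cis (2 * pi * (real n * tail (Suc j) \<omega>))"
    using int by (simp only: cis_mult[symmetric] cis_multiple_2pi mult_1_right)
  then have "point \<omega> ^ n = cis (2 * pi * (real n * tail (Suc j) \<omega>))"
    by (simp only: point_def Complex.DeMoivre)
  then have "1 - 2 * pi * (real n * tail (Suc j) \<omega>) \<le> Re (point \<omega> ^ n)"
    using cos_ge_one_minus_abs[of "2 * pi * (real n * tail (Suc j) \<omega>)"] tail_nonneg[of "Suc j" \<omega>]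
    by simp
  \<comment> \<open>Here \<open>k' \<le> k\<close> enters, through
    \<open>n \<le> (b * c) ^ k \<le> 6 ^ e j\<close>. Against
    \<open>w (Suc j) \<le> 1 / 16 ^ e j\<close> this leaves the ratio 6/16 = 3/8 to the power
    \<open>e j\<close>, and \<open>e j\<close> is at least \<open>C\<close>.\<close>
  moreover have "real n * tail (Suc j) \<omega> \<le> 2 * (1 / 2) ^ C"
  proof -
    have "n \<le> b ^ k * c ^ k"
      unfolding n_def using c assms(1) by (intro mult_left_mono power_increasing) auto
    also have "\<dots> \<le> 6 ^ e j"
      using bc assms(3) by (simp flip: power_mult_distrib)
        (meson order_trans power_mono power_increasing less_imp_le one_le_numeral zero_le)
    finally have "real n \<le> 6 ^ e j"
      by (metis of_nat_le_iff of_nat_numeral of_nat_power)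
    moreover have "w (Suc j) \<le> 1 / 16 ^ e j"
    proof -
      have "(16::real) ^ e j = 2 ^ (4 * e j)"
        by (simp add: power_mult)
      also have "\<dots> \<le> real b ^ e (Suc j)"
        unfolding e_Suc using b by (intro power_mono) auto
      finally show ?thesis
        using b by (simp add: w_def field_simps)
    qed
    ultimately have "real n * tail (Suc j) \<omega> \<le> 6 ^ e j * (2 * (1 / 16 ^ e j))"
      using tail_le[of "Suc j" \<omega>] tail_nonneg[of "Suc j" \<omega>] by (intro mult_mono) auto
    also have "\<dots> = 2 * (3 / 8) ^ e j"
      by (simp add: power_divide flip: power_mult_distrib)
        (simp add: field_simps flip: power_mult_distrib)
    also have "\<dots> \<le> 2 * (1 / 2) ^ e j"
      by (intro mult_left_mono power_mono) auto
    also have "\<dots> \<le> 2 * (1 / 2) ^ C"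
    proof -
      have "m \<le> 4 ^ m" for m :: nat
        using less_exp[of m] power_mono[of 2 "4::nat" m] by linarith
      from this[of "j + C"] have "C \<le> e j"
        unfolding e_def by linarith
      then show ?thesis
        by (intro mult_left_mono power_decreasing) auto
    qed
    finally show ?thesis .
  qed
  then have "2 * pi * (real n * tail (Suc j) \<omega>) \<le> 2 * pi * (2 * (1 / 2) ^ C)"
    by (rule mult_left_mono) simp
  ultimately show ?thesis
    unfolding n_def[symmetric] by linarith
qed

end

section \<open>Independent biased coins and the measures they produce\<close>

definition coins :: "real \<Rightarrow> (nat \<Rightarrow> bool) measure"
  where "coins p = (\<Pi>\<^sub>M i\<in>UNIV. measure_pmf (bernoulli_pmf p))"

lemma product_prob_space_coins: "product_prob_space (\<lambda>_. measure_pmf (bernoulli_pmf p))"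
  by (intro product_prob_spaceI prob_space_measure_pmf)

lemma prob_space_coins: "prob_space (coins p)"
  unfolding coins_def by (intro prob_space_PiM prob_space_measure_pmf)

lemma space_coins [simp]: "space (coins p) = UNIV"
  by (simp add: coins_def space_PiM)

lemma coins_component [measurable]: "Measurable.pred (coins p) (\<lambda>\<omega>. \<omega> i)"
proof -
  have "(\<lambda>\<omega>. \<omega> i) \<in> coins p \<rightarrow>\<^sub>M measure_pmf (bernoulli_pmf p)"
    unfolding coins_def by (rule measurable_component_singleton) simp
  then show ?thesis
    by simp
qed

lemma coins_prob:
  assumes "0 \<le> p" "p \<le> 1"
  shows "measure (coins p) {\<omega>. \<omega> i} = p"
proof -
  interpret product_prob_space "\<lambda>_::nat. measure_pmf (bernoulli_pmf p)" UNIV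
    by (rule product_prob_space_coins)
  have "emeasure (coins p) {\<omega>. \<omega> i} = emeasure (measure_pmf (bernoulli_pmf p)) {True}"
    using emeasure_PiM_Collect_single[of i "{True}"] by (simp add: coins_def space_PiM)
  then show ?thesis
    using assms by (simp add: measure_def emeasure_pmf_single)
qed

text \<open>Agreement with a given sequence in the first \<open>n\<close> coins has probability at
  most \<open>r ^ n\<close>, where \<open>r < 1\<close> because neither face is certain.\<close>

lemma coins_singleton:
  assumes "0 < p" "p < 1"
  shows "emeasure (coins p) {\<omega>} = 0"
proof -
  interpret product_prob_space "\<lambda>_::nat. measure_pmf (bernoulli_pmf p)" UNIV
    by (rule product_prob_space_coins)
  interpret coins: prob_space "coins p"
    by (rule prob_space_coins)
  define r where "r = max p (1 - p)"
  have r: "0 \<le> r" "r < 1"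
    using assms by (auto simp: r_def)
  have le: "measure (coins p) {\<omega>} \<le> r ^ n" for n
  proof -
    define A where "A = {x. \<forall>i\<in>{..<n}. x i \<in> {\<omega> i}}"
    have "Measurable.pred (coins p) (\<lambda>x. \<forall>i\<in>{..<n}. x i = \<omega> i)"
      by measurable
    then have "{x. \<forall>i\<in>{..<n}. x i = \<omega> i} \<in> sets (coins p)"
      by (simp add: pred_def)
    then have "measure (coins p) {\<omega>} \<le> measure (coins p) A"
      by (intro coins.finite_measure_mono) (auto simp: A_def)
    also have "ennreal (measure (coins p) A)
        = (\<Prod>i<n. emeasure (measure_pmf (bernoulli_pmf p)) {\<omega> i})"
      using emeasure_PiM_Collect[of "{..<n}" "\<lambda>i. {\<omega> i}"]
      by (simp add: coins_def space_PiM A_def coins.emeasure_eq_measure[symmetric, unfolded coins_def])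
    then have "measure (coins p) A = (\<Prod>i<n. pmf (bernoulli_pmf p) (\<omega> i))"
      by (simp add: emeasure_pmf_single prod_ennreal prod_nonneg)
    also have "\<dots> \<le> (\<Prod>i<n. r)"
    proof (intro prod_mono conjI pmf_nonneg)
      fix i
      show "pmf (bernoulli_pmf p) (\<omega> i) \<le> r"
        using assms by (cases "\<omega> i") (auto simp: r_def)
    qed
    finally show ?thesis
      by simp
  qed
  have "measure (coins p) {\<omega>} \<le> 0"
    using r le by (intro LIMSEQ_le_const[OF LIMSEQ_power_zero]) auto
  then show ?thesis
    using measure_nonneg[of "coins p" "{\<omega>}"] by (simp add: coins.emeasure_eq_measure)
qed

text \<open>For given \<open>k\<close> only one coin can spoil the power. Heads on it lowers the
  real part to -1 at worst, so the expectation is at least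
  \<open>1 - \<epsilon> / 2 - 2 * p\<close>: half of \<epsilon> covers the later roots, half covers
  the bad coin.\<close>

lemma circle_measure_near_one:
  fixes b c :: nat
  assumes "2 \<le> b" "1 \<le> c" "b * c \<le> 6" "0 < \<epsilon>"
  obtains \<mu> where "circle_prob_measure \<mu>" "continuous_measure \<mu>"
    "\<And>k k'. k' \<le> k \<Longrightarrow> 1 - \<epsilon> \<le> Re (fourier_coeff \<mu> (int b ^ k * int c ^ k'))"
proof -
  obtain C0 where C0: "(1 / 2 :: real) ^ C0 < \<epsilon> / (8 * pi)"
    using real_arch_pow_inv[of "\<epsilon> / (8 * pi)" "1 / 2"] \<open>0 < \<epsilon>\<close> by auto
  \<comment> \<open>The successor guarantees \<open>1 \<le> C\<close>, as the locale
    requires.\<close>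
  define C where "C = Suc C0"
  have small: "4 * pi * (1 / 2) ^ C \<le> \<epsilon> / 2"
    using C0 pi_ge_two by (simp add: C_def field_simps)
  \<comment> \<open>The bound \<open>\<epsilon> / 4\<close> gives
    \<open>2 * p \<le> \<epsilon> / 2\<close>; the bound 1/2 keeps \<open>p\<close> below 1, so that
    no coin sequence has positive mass.\<close>
  define p where "p = min (1 / 2) (\<epsilon> / 4)"
  have p: "0 < p" "p < 1" "2 * p \<le> \<epsilon> / 2"
    using \<open>0 < \<epsilon>\<close> by (auto simp: p_def)
  interpret lacunary_angles b c C
    using assms by unfold_locales (auto simp: C_def)
  interpret P: prob_space "coins p"
    by (rule prob_space_coins)
  have "angle \<in> borel_measurable (coins p)"
    unfolding angle_def[abs_def] by measurable
  then have meas: "point \<in> borel_measurable (coins p)"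
    unfolding point_def[abs_def]
    by (rule measurable_compose) (intro borel_measurable_continuous_onI continuous_intros)
  have norm: "norm (point \<omega>) = 1" for \<omega>
    by (simp add: point_def)
  note circ = circle_prob_measure_distr[OF prob_space_coins meas norm]
  define \<mu> where "\<mu> = distr (coins p) circle_borel point"
  show ?thesis
  proof
    show "circle_prob_measure \<mu>"
      unfolding \<mu>_def by (rule circ)
    show "continuous_measure \<mu>"
      unfolding continuous_measure_def
    proof
      fix z :: complex
      assume "z \<in> sphere 0 1"
      then have "emeasure \<mu> {z} = emeasure (coins p) (point -` {z})"
        unfolding \<mu>_def by (subst emeasure_distr[OF circ(2)]) (auto intro: circle_borel_singleton)
      also have "\<dots> = 0"
      proof (cases "\<exists>\<omega>. point \<omega> = z")
        case True
        then obtain \<omega> where "point -` {z} = {\<omega>}"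
          using inj_point by (auto simp: inj_def)
        then show ?thesis
          using coins_singleton[OF p(1,2)] by simp
      next
        case False
        then have "point -` {z} = {}"
          by auto
        then show ?thesis
          by simp
      qed
      finally show "measure \<mu> {z} = 0"
        by (simp add: measure_def)
    qed
    fix k k' :: nat
    assume "k' \<le> k"
    define n where "n = b ^ k * c ^ k'"
    \<comment> \<open>The one dangerous index: every earlier exponent is at most \<open>k\<close>,
      and \<open>k < e j\<close>.\<close>
    define j where "j = (LEAST j. k < e j)"
    have "k < 4 ^ (k + C)"
      using less_exp[of "k + C"] power_mono[of 2 "4::nat" "k + C"] by linarith
    then have j: "k < e j"
      unfolding j_def e_def by (rule LeastI)
    have j': "e i \<le> k" if "i < j" for i
      using not_less_Least[of i "\<lambda>j. k < e j"] that unfolding j_def by simp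
    have lower: "1 - \<epsilon> / 2 - 2 * of_bool (\<omega> j) \<le> Re (point \<omega> ^ n)" for \<omega>
    proof (cases "\<omega> j")
      case True
      have "- 1 \<le> Re (point \<omega> ^ n)"
        using abs_Re_le_cmod[of "point \<omega> ^ n"] by (simp add: norm_power norm)
      then show ?thesis
        using True \<open>0 < \<epsilon>\<close> by simp
    next
      case False
      then show ?thesis
        using point_power_close[of k' k j \<omega>] \<open>k' \<le> k\<close> j' j small by (simp add: n_def)
    qed
    have int: "integrable (coins p) (\<lambda>\<omega>. point \<omega> ^ n)"
      using meas by (intro P.integrable_const_bound[of _ 1]) (auto simp: norm_power norm)
    have int_j: "integrable (coins p) (\<lambda>\<omega>. of_bool (\<omega> j) :: real)"
      by (intro P.integrable_const_bound[of _ 1]) auto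
    have "(\<integral>\<omega>. of_bool (\<omega> j) \<partial>coins p) = measure (coins p) {\<omega>. \<omega> j}"
    proof -
      have "(\<integral>\<omega>. of_bool (\<omega> j) \<partial>coins p) = (\<integral>\<omega>. indicator {\<omega>. \<omega> j} \<omega> \<partial>coins p :: real)"
        by (intro Bochner_Integration.integral_cong) (auto simp: indicator_def)
      then show ?thesis
        by simp
    qed
    then have "1 - \<epsilon> \<le> (\<integral>\<omega>. 1 - \<epsilon> / 2 - 2 * of_bool (\<omega> j) \<partial>coins p)"
      using p int_j by (simp add: coins_prob P.prob_space[simplified])
    also have "\<dots> \<le> (\<integral>\<omega>. Re (point \<omega> ^ n) \<partial>coins p)"
      using int int_j lower by (intro integral_mono) auto
    also have "\<dots> = Re (\<integral>\<omega>. point \<omega> ^ n \<partial>coins p)"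
      using int by simp
    also have "(\<integral>\<omega>. point \<omega> ^ n \<partial>coins p) = fourier_coeff \<mu> (int n)"
      unfolding \<mu>_def by (simp add: fourier_coeff_distr[OF circ(2)])
    finally show "1 - \<epsilon> \<le> Re (fourier_coeff \<mu> (int b ^ k * int c ^ k'))"
      by (simp add: n_def)
  qed
qed

text \<open>At each element of F one of the two symmetrized measures has a coefficient of at least
  \<open>(1 - \<epsilon>)\<^sup>2\<close> and the other a nonnegative one, so half of that square
  survives in the average. The uniform bound \<delta>' is carried along because values above
  \<delta> need not have an infimum above \<delta>.\<close>

lemma exists_furstenberg_measure:
  fixes \<delta> :: real
  assumes "0 < \<delta>" "\<delta> < 1 / 2"
  obtains \<mu> \<delta>' where "circle_prob_measure \<mu>" "continuous_measure \<mu>" "nonneg_fourier_coeffs \<mu>"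
    "\<delta> < \<delta>'" "\<And>k k'. \<delta>' \<le> Re (fourier_coeff \<mu> (2 ^ k * 3 ^ k'))"
proof -
  \<comment> \<open>With this \<epsilon>, \<open>(1 - 2 * \<epsilon>) / 2\<close> is the midpoint of
    \<delta> and 1/2, and it is a lower bound for
    \<open>(1 - \<epsilon>)\<^sup>2 / 2\<close>.\<close>
  define \<epsilon> where "\<epsilon> = 1 / 4 - \<delta> / 2"
  have \<epsilon>: "0 < \<epsilon>" "\<epsilon> \<le> 1"
    using assms by (auto simp: \<epsilon>_def)
  obtain \<mu>2 where \<mu>2: "circle_prob_measure \<mu>2" "continuous_measure \<mu>2"
    "\<And>k k'. k' \<le> k \<Longrightarrow> 1 - \<epsilon> \<le> Re (fourier_coeff \<mu>2 (2 ^ k * 3 ^ k'))"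
    using circle_measure_near_one[of 2 3 \<epsilon>] \<epsilon> by auto
  obtain \<mu>3 where \<mu>3: "circle_prob_measure \<mu>3" "continuous_measure \<mu>3"
    "\<And>k k'. k' \<le> k \<Longrightarrow> 1 - \<epsilon> \<le> Re (fourier_coeff \<mu>3 (3 ^ k * 2 ^ k'))"
    using circle_measure_near_one[of 3 2 \<epsilon>] \<epsilon> by auto
  obtain \<nu>2 where \<nu>2: "circle_prob_measure \<nu>2" "continuous_measure \<nu>2"
    "\<And>n. fourier_coeff \<nu>2 n = of_real ((cmod (fourier_coeff \<mu>2 n))\<^sup>2)"
    using circle_symmetrization[OF \<mu>2(1,2)] by blast
  obtain \<nu>3 where \<nu>3: "circle_prob_measure \<nu>3" "continuous_measure \<nu>3"
    "\<And>n. fourier_coeff \<nu>3 n = of_real ((cmod (fourier_coeff \<mu>3 n))\<^sup>2)"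
    using circle_symmetrization[OF \<mu>3(1,2)] by blast
  obtain \<mu> where \<mu>: "circle_prob_measure \<mu>" "continuous_measure \<mu>"
    "\<And>n. fourier_coeff \<mu> n = (fourier_coeff \<nu>2 n + fourier_coeff \<nu>3 n) / 2"
    using circle_mixture[OF \<nu>2(1,2) \<nu>3(1,2)] by blast
  have coeff: "fourier_coeff \<mu> n
      = of_real (((cmod (fourier_coeff \<mu>2 n))\<^sup>2 + (cmod (fourier_coeff \<mu>3 n))\<^sup>2) / 2)" for n
    by (simp add: \<mu> \<nu>2 \<nu>3)
  show ?thesis
  proof
    show "circle_prob_measure \<mu>" "continuous_measure \<mu>"
      by fact+
    show "nonneg_fourier_coeffs \<mu>"
      unfolding nonneg_fourier_coeffs_def coeff by (simp del: of_real_divide of_real_add of_real_power)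
    show "\<delta> < (1 - \<epsilon>)\<^sup>2 / 2"
    proof -
      have "\<delta> < (1 - 2 * \<epsilon>) / 2"
        using assms by (simp add: \<epsilon>_def)
      also have "\<dots> \<le> (1 - \<epsilon>)\<^sup>2 / 2"
        by (simp add: power2_diff)
      finally show ?thesis .
    qed
    fix k k' :: nat
    have sq: "(1 - \<epsilon>)\<^sup>2 \<le> (cmod z)\<^sup>2" if "1 - \<epsilon> \<le> Re z" for z
      using that complex_Re_le_cmod[of z] \<epsilon> by (intro power_mono) auto
    show "(1 - \<epsilon>)\<^sup>2 / 2 \<le> Re (fourier_coeff \<mu> (2 ^ k * 3 ^ k'))"
    proof (cases "k' \<le> k")
      case True
      then show ?thesis
        using sq[OF \<mu>2(3)[OF True]] by (simp add: coeff add_increasing2)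
    next
      \<comment> \<open>Now 3 has the larger exponent, which is the range controlled by
        \<mu>3.\<close>
      case False
      then have "k \<le> k'"
        by simp
      from sq[OF \<mu>3(3)[OF this]] show ?thesis
        by (simp add: coeff mult.commute add_increasing)
    qed
  qed
qed

section \<open>Multiplication by the coordinate on Laurent polynomials\<close>

text \<open>The geometric sums stay bounded by \<open>2 / norm (u - 1)\<close>. This is the
  pointwise convergence off the diagonal in Wiener's lemma.\<close>

lemma geometric_mean_tendsto_zero:
  fixes u :: complex
  assumes "norm u = 1" "u \<noteq> 1"
  shows "(\<lambda>N. (\<Sum>n<N. u ^ n) / of_nat N) \<longlonglongrightarrow> 0"
proof (rule Lim_null_comparison)
  have "norm ((\<Sum>n<N. u ^ n) / of_nat N) \<le> (2 / norm (u - 1)) * (1 / real N)" for N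
  proof -
    have "norm (u ^ N - 1) \<le> 2"
      using norm_triangle_ineq4[of "u ^ N" 1] assms(1) by (simp add: norm_power)
    then have "norm (u ^ N - 1) / norm (u - 1) \<le> 2 / norm (u - 1)"
      by (rule divide_right_mono) simp
    then have "norm (\<Sum>n<N. u ^ n) \<le> 2 / norm (u - 1)"
      using geometric_sum[OF assms(2), of N] by (simp add: norm_divide)
    then show ?thesis
      using mult_right_mono[of "norm (\<Sum>n<N. u ^ n)" "2 / norm (u - 1)" "1 / real N"]
      by (simp add: norm_divide)
  qed
  then show "\<forall>\<^sub>F N in sequentially. norm ((\<Sum>n<N. u ^ n) / of_nat N) \<le> (2 / norm (u - 1)) * (1 / real N)"
    by simp
  show "(\<lambda>N. (2 / norm (u - 1)) * (1 / real N)) \<longlonglongrightarrow> 0"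
    using tendsto_mult_left[OF lim_1_over_n, of "2 / norm (u - 1)"] by simp
qed

text \<open>
  One direction of Wiener's lemma: the Cesaro means of \<open>\<bar>a n\<bar>\<^sup>2\<close> tend to
  the integral of \<open>h x * cnj (h y)\<close> over the diagonal, a null set for the product measure.
\<close>

lemma Wiener_small_coefficient:
  fixes h :: "complex \<Rightarrow> complex"
  assumes \<mu>: "circle_prob_measure \<mu>" and cont: "continuous_measure \<mu>"
    and h: "continuous_on (sphere 0 1) h" and "\<epsilon> > 0"
  shows "\<exists>n::nat. cmod (\<integral>z. z ^ n * h z \<partial>\<mu>) < \<epsilon>"
proof (rule ccontr)
  define a where "a n = (\<integral>z. z ^ n * h z \<partial>\<mu>)" for n :: nat
  assume "\<not> (\<exists>n::nat. cmod (\<integral>z. z ^ n * h z \<partial>\<mu>) < \<epsilon>)"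
  then have large: "\<epsilon> \<le> cmod (a n)" for n
    unfolding a_def by (meson not_le)
  interpret prob_space \<mu>
    by (rule circle_prob_space[OF \<mu>])
  interpret P: pair_prob_space \<mu> \<mu> ..
  have space: "space (\<mu> \<Otimes>\<^sub>M \<mu>) = sphere 0 1 \<times> sphere 0 1"
    by (simp add: space_pair_measure circle_space[OF \<mu>])
  have "bounded (h ` sphere 0 1)"
    by (intro compact_imp_bounded compact_continuous_image h compact_sphere)
  then obtain B where B: "\<And>z. z \<in> sphere 0 1 \<Longrightarrow> cmod (h z) \<le> B"
    unfolding bounded_iff by blast
  have "B \<ge> 0"
    using order_trans[OF norm_ge_zero B[of 1]] by simp
  define H where "H w = h (fst w) * cnj (h (snd w))" for w
  define u where "u w = fst w * cnj (snd w)" for w :: "complex \<times> complex"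
  have u_meas [measurable]: "u \<in> borel_measurable (\<mu> \<Otimes>\<^sub>M \<mu>)"
    unfolding u_def[abs_def] by (rule circle_quotient_measurable[OF \<mu>])
  have H_meas [measurable]: "H \<in> borel_measurable (\<mu> \<Otimes>\<^sub>M \<mu>)"
    unfolding H_def[abs_def]
    by (rule borel_measurable_times measurable_compose[OF measurable_fst]
        measurable_compose[OF measurable_snd] circle_measurable_continuous[OF \<mu>]
        h continuous_on_cnj)+
  have norm_u: "cmod (u w) = 1" and norm_H: "cmod (H w) \<le> B * B"
    if "w \<in> space (\<mu> \<Otimes>\<^sub>M \<mu>)" for w
    using that B \<open>B \<ge> 0\<close> by (auto simp: space u_def H_def norm_mult intro!: mult_mono)
  have int: "integrable (\<mu> \<Otimes>\<^sub>M \<mu>) (\<lambda>w. u w ^ n * H w)" for n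
    using norm_u norm_H
    by (intro P.integrable_const_bound[of _ "B * B"]) (auto simp: norm_mult norm_power intro!: AE_I2)
  have a_sq: "(\<integral>w. u w ^ n * H w \<partial>(\<mu> \<Otimes>\<^sub>M \<mu>)) = of_real ((cmod (a n))\<^sup>2)" for n
  proof -
    have "(\<integral>w. u w ^ n * H w \<partial>(\<mu> \<Otimes>\<^sub>M \<mu>)) = (\<integral>x. \<integral>y. u (x, y) ^ n * H (x, y) \<partial>\<mu> \<partial>\<mu>)"
      using P.integral_fst'[OF int] by simp
    also have "\<dots> = (\<integral>x. \<integral>y. (x ^ n * h x) * cnj (y ^ n * h y) \<partial>\<mu> \<partial>\<mu>)"
      by (simp add: u_def H_def power_mult_distrib mult_ac)
    also have "\<dots> = a n * cnj (a n)"
      unfolding a_def by (simp del: complex_cnj_mult complex_cnj_power)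
    finally show ?thesis
      by (simp only: complex_norm_square)
  qed
  \<comment> \<open>The integral of \<open>s N\<close> is the Cesaro mean of the squared moduli of
    \<open>a n\<close>, because each of these is the integral of \<open>u w ^ n * H w\<close>. Off
    the null set where \<open>u w = 1\<close> the integrand tends to 0, with \<open>B * B\<close> as
    dominating constant.\<close>
  define s where "s N w = (\<Sum>n<N. u w ^ n) / of_nat N * H w" for N w
  have "(\<lambda>N. \<integral>w. s N w \<partial>(\<mu> \<Otimes>\<^sub>M \<mu>)) \<longlonglongrightarrow> (\<integral>w. 0 \<partial>(\<mu> \<Otimes>\<^sub>M \<mu>))"
  proof (rule integral_dominated_convergence[where w = "\<lambda>_. B * B"])
    show "s N \<in> borel_measurable (\<mu> \<Otimes>\<^sub>M \<mu>)" for N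
      unfolding s_def[abs_def] by measurable
    have "{w \<in> space (\<mu> \<Otimes>\<^sub>M \<mu>). u w = 1} \<in> sets (\<mu> \<Otimes>\<^sub>M \<mu>)"
      by measurable
    then have "AE w in \<mu> \<Otimes>\<^sub>M \<mu>. u w \<noteq> 1"
      using circle_quotient_null[OF \<mu> cont, of 1] by (intro AE_I) (auto simp: u_def)
    then show "AE w in \<mu> \<Otimes>\<^sub>M \<mu>. (\<lambda>N. s N w) \<longlonglongrightarrow> 0"
    proof (rule AE_mp, intro AE_I2 impI)
      fix w
      assume "w \<in> space (\<mu> \<Otimes>\<^sub>M \<mu>)" "u w \<noteq> 1"
      then show "(\<lambda>N. s N w) \<longlonglongrightarrow> 0"
        unfolding s_def using tendsto_mult_left_zero[OF geometric_mean_tendsto_zero] norm_u by blast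
    qed
    show "AE w in \<mu> \<Otimes>\<^sub>M \<mu>. norm (s N w) \<le> B * B" for N
    proof (rule AE_I2)
      fix w
      assume w: "w \<in> space (\<mu> \<Otimes>\<^sub>M \<mu>)"
      have "cmod (\<Sum>n<N. u w ^ n) \<le> real N"
        using sum_norm_le[of "{..<N}" "\<lambda>n. u w ^ n" "\<lambda>_. 1"] norm_u[OF w] by (simp add: norm_power)
      \<comment> \<open>For \<open>N = 0\<close> the quotient is 0 by the convention on division by
        zero.\<close>
      then have "cmod ((\<Sum>n<N. u w ^ n) / of_nat N) \<le> 1"
        by (cases "N = 0") (simp_all add: norm_divide)
      then show "norm (s N w) \<le> B * B"
        unfolding s_def norm_mult using mult_mono[OF _ norm_H[OF w], of _ 1] by simp
    qed
  qed auto
  moreover have "(\<integral>w. s N w \<partial>(\<mu> \<Otimes>\<^sub>M \<mu>)) = of_real ((\<Sum>n<N. (cmod (a n))\<^sup>2) / real N)" for N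
  proof -
    have "(\<integral>w. s N w \<partial>(\<mu> \<Otimes>\<^sub>M \<mu>)) = (\<integral>w. (\<Sum>n<N. u w ^ n * H w) / of_nat N \<partial>(\<mu> \<Otimes>\<^sub>M \<mu>))"
      by (simp add: s_def sum_distrib_right)
    also have "\<dots> = (\<Sum>n<N. \<integral>w. u w ^ n * H w \<partial>(\<mu> \<Otimes>\<^sub>M \<mu>)) / of_nat N"
      using int by simp
    finally show ?thesis
      by (simp add: a_sq)
  qed
  ultimately have "(\<lambda>N. complex_of_real ((\<Sum>n<N. (cmod (a n))\<^sup>2) / real N)) \<longlonglongrightarrow> of_real 0"
    by simp
  then have "(\<lambda>N. (\<Sum>n<N. (cmod (a n))\<^sup>2) / real N) \<longlonglongrightarrow> 0"
    unfolding tendsto_of_real_iff .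
  \<comment> \<open>If every coefficient had modulus at least \<epsilon>, the means could not fall
    below the square of \<epsilon>.\<close>
  moreover have "\<epsilon>\<^sup>2 \<le> (\<Sum>n<N. (cmod (a n))\<^sup>2) / real N" if "N \<ge> 1" for N
  proof -
    have "real N * \<epsilon>\<^sup>2 \<le> (\<Sum>n<N. (cmod (a n))\<^sup>2)"
      using sum_mono[of "{..<N}" "\<lambda>_. \<epsilon>\<^sup>2" "\<lambda>n. (cmod (a n))\<^sup>2"] large \<open>\<epsilon> > 0\<close>
      by (simp add: power_mono)
    then show ?thesis
      using that by (simp add: field_simps)
  qed
  ultimately have "\<epsilon>\<^sup>2 \<le> 0"
    by (intro LIMSEQ_le_const) auto
  then show False
    using \<open>\<epsilon> > 0\<close> by simp
qed

section \<open>Laurent polynomials as finitely supported coefficient functions\<close>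

definition laurent_eval :: "(int \<Rightarrow>\<^sub>0 complex) \<Rightarrow> complex \<Rightarrow> complex"
  where "laurent_eval f z = (\<Sum>k\<in>Poly_Mapping.keys f. Poly_Mapping.lookup f k * z powi k)"

lemma laurent_eval_superset:
  assumes "finite A" "Poly_Mapping.keys f \<subseteq> A"
  shows "laurent_eval f z = (\<Sum>k\<in>A. Poly_Mapping.lookup f k * z powi k)"
  unfolding laurent_eval_def using assms
  by (intro sum.mono_neutral_left) (auto simp: in_keys_iff)

lemma laurent_eval_add: "laurent_eval (f + g) z = laurent_eval f z + laurent_eval g z"
  by (simp add: laurent_eval_superset[of "Poly_Mapping.keys f \<union> Poly_Mapping.keys g"] keys_add
      lookup_add distrib_right sum.distrib)

definition laurent_scale :: "complex \<Rightarrow> (int \<Rightarrow>\<^sub>0 complex) \<Rightarrow> (int \<Rightarrow>\<^sub>0 complex)"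
  where "laurent_scale c = Poly_Mapping.map ((*) c)"

lemma lookup_laurent_scale:
  "Poly_Mapping.lookup (laurent_scale c f) k = c * Poly_Mapping.lookup f k"
  by (simp add: laurent_scale_def Poly_Mapping.map.rep_eq when_def)

lemma laurent_eval_scale: "laurent_eval (laurent_scale c f) z = c * laurent_eval f z"
proof -
  have "Poly_Mapping.keys (laurent_scale c f) \<subseteq> Poly_Mapping.keys f"
    by (auto simp: in_keys_iff lookup_laurent_scale)
  then show ?thesis
    by (simp add: laurent_eval_superset[of "Poly_Mapping.keys f"] lookup_laurent_scale
        sum_distrib_left mult.assoc)
qed

text \<open>Reading coefficients at \<open>k - m\<close> raises every exponent by \<open>m\<close>,
  so this is multiplication by \<open>z powi m\<close>.\<close>

definition laurent_shift :: "int \<Rightarrow> (int \<Rightarrow>\<^sub>0 complex) \<Rightarrow> (int \<Rightarrow>\<^sub>0 complex)"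
  where "laurent_shift m = Poly_Mapping.map_key (\<lambda>k. k - m)"

lemma lookup_laurent_shift:
  "Poly_Mapping.lookup (laurent_shift m f) k = Poly_Mapping.lookup f (k - m)"
  by (simp add: laurent_shift_def map_key.rep_eq inj_def)

lemma laurent_eval_shift:
  assumes "z \<noteq> 0"
  shows "laurent_eval (laurent_shift m f) z = z powi m * laurent_eval f z"
proof -
  have "Poly_Mapping.keys (laurent_shift m f) \<subseteq> (\<lambda>k. k + m) ` Poly_Mapping.keys f"
  proof
    fix k
    assume "k \<in> Poly_Mapping.keys (laurent_shift m f)"
    then have "k - m \<in> Poly_Mapping.keys f"
      by (simp add: in_keys_iff lookup_laurent_shift)
    then have "k - m + m \<in> (\<lambda>k. k + m) ` Poly_Mapping.keys f"
      by (rule imageI)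
    then show "k \<in> (\<lambda>k. k + m) ` Poly_Mapping.keys f"
      by simp
  qed
  then have "laurent_eval (laurent_shift m f) z
      = (\<Sum>k\<in>(\<lambda>k. k + m) ` Poly_Mapping.keys f. Poly_Mapping.lookup f (k - m) * z powi k)"
    by (subst laurent_eval_superset) (auto simp: lookup_laurent_shift)
  also have "\<dots> = z powi m * laurent_eval f z"
    using assms by (subst sum.reindex)
      (auto simp: inj_on_def laurent_eval_def sum_distrib_left power_int_add mult_ac)
  finally show ?thesis .
qed

lemma continuous_on_laurent_eval: "continuous_on (sphere 0 1) (laurent_eval f)"
  unfolding laurent_eval_def[abs_def] by (intro continuous_intros) auto

text \<open>Each coefficient is rounded to a countable dense set \<open>R\<close>. On the circle all
  monomials have modulus 1, so the uniform error is at most the sum of the rounding errors, whatever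
  measure is used later.\<close>

lemma countable_dense_laurent:
  obtains D :: "(int \<Rightarrow>\<^sub>0 complex) set" where "countable D"
    "\<And>f e. e > 0 \<Longrightarrow> \<exists>d\<in>D. \<forall>z\<in>sphere 0 1. cmod (laurent_eval (f - d) z) \<le> e"
proof -
  obtain R :: "complex set" where R: "countable R" "\<And>X. open X \<Longrightarrow> X \<noteq> {} \<Longrightarrow> \<exists>r\<in>R. r \<in> X"
    by (rule countable_dense_setE) blast
  \<comment> \<open>The graph turns a polynomial with coefficients in \<open>R\<close> into a finite
    subset of a countable set, and only countably many such subsets exist.\<close>
  define graph where "graph f = (\<lambda>k. (k, Poly_Mapping.lookup f k)) ` Poly_Mapping.keys f"
    for f :: "int \<Rightarrow>\<^sub>0 complex"
  define D where "D = {f :: int \<Rightarrow>\<^sub>0 complex. \<forall>k\<in>Poly_Mapping.keys f. Poly_Mapping.lookup f k \<in> R}"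
  have "inj_on graph D"
  proof (rule inj_onI, rule poly_mapping_eqI)
    fix f g k
    assume eq: "graph f = graph g"
    have "(k, c) \<in> graph f \<longleftrightarrow> c = Poly_Mapping.lookup f k \<and> c \<noteq> 0" for f c
      by (auto simp: graph_def in_keys_iff)
    then show "Poly_Mapping.lookup f k = Poly_Mapping.lookup g k"
      using eq by metis
  qed
  moreover have "countable (graph ` D)"
  proof (rule countable_subset)
    show "graph ` D \<subseteq> {A. finite A \<and> A \<subseteq> UNIV \<times> R}"
      by (auto simp: graph_def D_def)
    show "countable {A. finite A \<and> A \<subseteq> (UNIV :: int set) \<times> R}"
      using R(1) by (intro countable_Collect_finite_subset countable_SIGMA) auto
  qed
  ultimately have "countable D"
    using countable_image_inj_on by blast
  moreover have "\<exists>d\<in>D. \<forall>z\<in>sphere 0 1. cmod (laurent_eval (f - d) z) \<le> e"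
    if "e > 0" for f :: "int \<Rightarrow>\<^sub>0 complex" and e
  proof -
    \<comment> \<open>The added 1 keeps the denominator positive when \<open>f = 0\<close>.\<close>
    define \<eta> where "\<eta> = e / (real (card (Poly_Mapping.keys f)) + 1)"
    have \<eta>: "\<eta> > 0" "real (card (Poly_Mapping.keys f)) * \<eta> \<le> e"
      using that by (auto simp: \<eta>_def field_simps add_pos_nonneg)
    have "\<exists>r\<in>R. cmod (c - r) < \<eta>" for c
      using R(2)[of "ball c \<eta>"] \<eta>(1) by (auto simp: dist_norm)
    then obtain r where r: "\<And>c. r c \<in> R" "\<And>c. cmod (c - r c) < \<eta>"
      by metis
    \<comment> \<open>\<open>Poly_Mapping.map\<close> leaves zero coefficients at zero, so
      \<open>d\<close> has finite support even if \<open>r 0\<close> is not 0.\<close>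
    define d where "d = Poly_Mapping.map r f"
    have d: "Poly_Mapping.lookup d k
        = (if k \<in> Poly_Mapping.keys f then r (Poly_Mapping.lookup f k) else 0)" for k
      by (simp add: d_def Poly_Mapping.map.rep_eq when_def in_keys_iff)
    have keys_d: "Poly_Mapping.keys d \<subseteq> Poly_Mapping.keys f"
      by (auto simp: d in_keys_iff[of _ d] split: if_splits)
    then have "d \<in> D"
      using r(1) by (auto simp: D_def d)
    moreover have "cmod (laurent_eval (f - d) z) \<le> e" if "z \<in> sphere 0 1" for z
    proof -
      have "Poly_Mapping.keys (f - d) \<subseteq> Poly_Mapping.keys f"
        by (auto simp: in_keys_iff lookup_minus d)
      then have "cmod (laurent_eval (f - d) z)
          = cmod (\<Sum>k\<in>Poly_Mapping.keys f.
              (Poly_Mapping.lookup f k - Poly_Mapping.lookup d k) * z powi k)"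
        by (simp add: laurent_eval_superset[of "Poly_Mapping.keys f"] lookup_minus)
      also have "\<dots> \<le> (\<Sum>k\<in>Poly_Mapping.keys f. \<eta>)"
        using that r(2) by (intro sum_norm_le) (auto simp: norm_mult norm_power_int d intro: less_imp_le)
      finally show ?thesis
        using \<eta>(2) by simp
    qed
    ultimately show ?thesis
      by blast
  qed
  ultimately show ?thesis
    by (rule that)
qed

section \<open>The form of \<open>L\<^sup>2(\<mu>)\<close> and the Kazhdan constant\<close>

definition laurent_ip :: "complex measure \<Rightarrow> (int \<Rightarrow>\<^sub>0 complex) \<Rightarrow> (int \<Rightarrow>\<^sub>0 complex) \<Rightarrow> complex"
  where "laurent_ip \<mu> f g = (\<integral>z. laurent_eval f z * cnj (laurent_eval g z) \<partial>\<mu>)"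

lemma laurent_ip_integrable:
  "circle_prob_measure \<mu> \<Longrightarrow> integrable \<mu> (\<lambda>z. laurent_eval f z * cnj (laurent_eval g z))"
  by (intro circle_integrable_continuous continuous_intros continuous_on_laurent_eval)

lemma laurent_ip_self:
  assumes "circle_prob_measure \<mu>"
  shows "Re (laurent_ip \<mu> f f) = (\<integral>z. (cmod (laurent_eval f z))\<^sup>2 \<partial>\<mu>)"
  unfolding laurent_ip_def
  by (subst integral_Re[symmetric, OF laurent_ip_integrable[OF assms]])
    (simp flip: complex_norm_square)

lemma laurent_ip_self_le:
  assumes \<mu>: "circle_prob_measure \<mu>" and "\<And>z. z \<in> sphere 0 1 \<Longrightarrow> cmod (laurent_eval f z) \<le> e"
  shows "Re (laurent_ip \<mu> f f) \<le> e\<^sup>2"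
proof -
  interpret prob_space \<mu>
    by (rule circle_prob_space[OF \<mu>])
  have "Re (laurent_ip \<mu> f f) \<le> (\<integral>z. e\<^sup>2 \<partial>\<mu>)"
    unfolding laurent_ip_self[OF \<mu>]
  proof (rule integral_mono)
    have "integrable \<mu> (\<lambda>z. Re (laurent_eval f z * cnj (laurent_eval f z)))"
      by (intro integrable_Re laurent_ip_integrable[OF \<mu>])
    then show "integrable \<mu> (\<lambda>z. (cmod (laurent_eval f z))\<^sup>2)"
      by (simp flip: complex_norm_square)
  qed (use assms(2) in \<open>auto simp: circle_space[OF \<mu>] intro!: power_mono\<close>)
  then show ?thesis
    by (simp add: prob_space)
qed

text \<open>The operator is multiplication by \<open>z\<close> and the vector is the constant 1. On
  the circle the squared modulus of \<open>z powi q - 1\<close> equals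
  \<open>2 - 2 * Re (z powi q)\<close>, whose integral involves only the \<open>q\<close>-th
  coefficient.\<close>

lemma modified_Kazhdan_constant_fourier:
  assumes \<mu>: "circle_prob_measure \<mu>" and cont: "continuous_measure \<mu>"
    and Q: "\<And>q. q \<in> Q \<Longrightarrow> 0 \<le> q" "\<And>q. q \<in> Q \<Longrightarrow> \<delta> \<le> Re (fourier_coeff \<mu> q)"
  shows "modified_Kazhdan_constant Q \<le> ennreal (sqrt (2 - 2 * \<delta>))"
proof -
  interpret prob_space \<mu>
    by (rule circle_prob_space[OF \<mu>])
  obtain D :: "(int \<Rightarrow>\<^sub>0 complex) set" where D: "countable D"
    "\<And>f e. e > 0 \<Longrightarrow> \<exists>d\<in>D. \<forall>z\<in>sphere 0 1. cmod (laurent_eval (f - d) z) \<le> e"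
    by (rule countable_dense_laurent) blast
  note int = laurent_ip_integrable[OF \<mu>]
  have unit: "z powi m * cnj (z powi m) = 1" if "z \<in> space \<mu>" for z m
    using that circle_space[OF \<mu>]
    unfolding complex_norm_square[symmetric] by (simp add: norm_power_int)
  interpret semi_inner_space laurent_scale "laurent_ip \<mu>" D
  proof
    fix f g h :: "int \<Rightarrow>\<^sub>0 complex" and c
    show "laurent_ip \<mu> (f + g) h = laurent_ip \<mu> f h + laurent_ip \<mu> g h"
      using int by (simp add: laurent_ip_def laurent_eval_add distrib_right)
    show "laurent_ip \<mu> (laurent_scale c f) g = c * laurent_ip \<mu> f g"
      using int by (simp add: laurent_ip_def laurent_eval_scale mult.assoc)
    show "laurent_ip \<mu> g f = cnj (laurent_ip \<mu> f g)"
      unfolding laurent_ip_def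
      by (subst Bochner_Integration.integral_cnj[symmetric]) (simp add: mult.commute)
    show "0 \<le> Re (laurent_ip \<mu> f f)"
      by (simp add: laurent_ip_self[OF \<mu>])
    show "countable D"
      by fact
    fix e :: real
    assume "e > 0"
    then obtain d where "d \<in> D" "\<forall>z\<in>sphere 0 1. cmod (laurent_eval (f - d) z) \<le> sqrt (e / 2)"
      using D(2)[of "sqrt (e / 2)"] by auto
    then show "\<exists>d\<in>D. Re (laurent_ip \<mu> (f - d) (f - d)) < e"
      using laurent_ip_self_le[OF \<mu>, of "f - d" "sqrt (e / 2)"] \<open>e > 0\<close> by force
  qed
  \<comment> \<open>Multiplication by \<open>z\<close> preserves the form because
    \<open>z * cnj z = 1\<close> on the circle; multiplication by the inverse of \<open>z\<close>
    undoes it.\<close>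
  interpret semi_inner_space_isometry laurent_scale "laurent_ip \<mu>" D
    "laurent_shift 1" "laurent_shift (- 1)"
  proof
    fix f g :: "int \<Rightarrow>\<^sub>0 complex" and c
    show "laurent_shift 1 (f + g) = laurent_shift 1 f + laurent_shift 1 g"
      "laurent_shift 1 (laurent_scale c f) = laurent_scale c (laurent_shift 1 f)"
      "laurent_shift 1 (laurent_shift (- 1) f) = f"
      by (rule poly_mapping_eqI; simp add: lookup_laurent_shift lookup_add lookup_laurent_scale)+
    show "laurent_ip \<mu> (laurent_shift 1 f) (laurent_shift 1 g) = laurent_ip \<mu> f g"
      unfolding laurent_ip_def
    proof (rule Bochner_Integration.integral_cong)
      fix z
      assume z: "z \<in> space \<mu>"
      then have "z \<noteq> 0"
        using circle_space[OF \<mu>] by auto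
      then have "laurent_eval (laurent_shift 1 f) z * cnj (laurent_eval (laurent_shift 1 g) z)
          = (z * cnj z) * (laurent_eval f z * cnj (laurent_eval g z))"
        by (simp add: laurent_eval_shift)
      then show "laurent_eval (laurent_shift 1 f) z * cnj (laurent_eval (laurent_shift 1 g) z)
          = laurent_eval f z * cnj (laurent_eval g z)"
        using unit[OF z, of 1] by simp
    qed simp
  qed
  have iter: "(laurent_shift 1 ^^ n) f = laurent_shift (int n) f" for n f
    by (induction n; rule poly_mapping_eqI) (simp_all add: lookup_laurent_shift algebra_simps)
  have mixing: "\<exists>n. cmod (laurent_ip \<mu> ((laurent_shift 1 ^^ n) f) f) < e" if pos: "e > 0" for f e
  proof -
    \<comment> \<open>The inner product of the \<open>n\<close>-th iterate of \<open>f\<close> with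
      \<open>f\<close> is an integral of \<open>z ^ n\<close> against the continuous density given
      by the squared modulus of \<open>f\<close>, the situation of Wiener's lemma.\<close>
    have "continuous_on (sphere 0 1) (\<lambda>z. laurent_eval f z * cnj (laurent_eval f z))"
      by (intro continuous_intros continuous_on_laurent_eval)
    then obtain n :: nat
      where n: "cmod (\<integral>z. z ^ n * (laurent_eval f z * cnj (laurent_eval f z)) \<partial>\<mu>) < e"
      using Wiener_small_coefficient[OF \<mu> cont _ pos] by blast
    have "laurent_ip \<mu> ((laurent_shift 1 ^^ n) f) f
        = (\<integral>z. z ^ n * (laurent_eval f z * cnj (laurent_eval f z)) \<partial>\<mu>)"
      unfolding laurent_ip_def iter
    proof (rule Bochner_Integration.integral_cong)
      fix z
      assume "z \<in> space \<mu>"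
      then have "z \<noteq> 0"
        using circle_space[OF \<mu>] by auto
      then show "laurent_eval (laurent_shift (int n) f) z * cnj (laurent_eval f z)
          = z ^ n * (laurent_eval f z * cnj (laurent_eval f z))"
        by (simp add: laurent_eval_shift)
    qed simp
    then show ?thesis
      using n by (intro exI[of _ n]) (simp only:)
  qed
  define x :: "int \<Rightarrow>\<^sub>0 complex" where "x = Poly_Mapping.single 0 1"
  have eval_x: "laurent_eval x z = 1" for z
    by (simp add: x_def laurent_eval_def)
  have "snorm x = 1"
    by (simp add: snorm_def laurent_ip_def eval_x prob_space)
  have "modified_Kazhdan_constant Q
      \<le> (SUP q\<in>Q. ennreal (snorm ((laurent_shift 1 ^^ nat q) x - x)))"
    by (rule modified_Kazhdan_constant_le[OF mixing \<open>snorm x = 1\<close> Q(1)])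
  also have "\<dots> \<le> ennreal (sqrt (2 - 2 * \<delta>))"
  proof (rule SUP_least, rule ennreal_leI)
    fix q
    assume q: "q \<in> Q"
    have powi: "integrable \<mu> (\<lambda>z. z powi q)"
      by (rule circle_integrable_continuous[OF \<mu> continuous_on_circle_powi])
    have "laurent_ip \<mu> (laurent_shift q x - x) (laurent_shift q x - x)
        = (\<integral>z. 2 - of_real (2 * Re (z powi q)) \<partial>\<mu>)"
      unfolding laurent_ip_def
    proof (rule Bochner_Integration.integral_cong)
      fix z
      assume z: "z \<in> space \<mu>"
      then have "z \<noteq> 0"
        using circle_space[OF \<mu>] by auto
      then have "laurent_eval (laurent_shift q x - x) z = z powi q - 1"
        using laurent_eval_add[of "laurent_shift q x - x" x z]
        by (simp add: laurent_eval_shift eval_x algebra_simps)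
      moreover have "(z powi q - 1) * cnj (z powi q - 1) = 2 - of_real (2 * Re (z powi q))"
        using unit[OF z, of q] complex_add_cnj[of "z powi q"] by (simp add: algebra_simps)
      ultimately show "laurent_eval (laurent_shift q x - x) z * cnj (laurent_eval (laurent_shift q x - x) z)
          = 2 - of_real (2 * Re (z powi q))"
        by simp
    qed simp
    then have "Re (laurent_ip \<mu> (laurent_shift q x - x) (laurent_shift q x - x))
        = 2 - 2 * Re (fourier_coeff \<mu> q)"
      using powi by (simp add: fourier_coeff_def prob_space)
    then show "snorm ((laurent_shift 1 ^^ nat q) x - x) \<le> sqrt (2 - 2 * \<delta>)"
      using Q[OF q] unfolding snorm_def iter by simp
  qed
  finally show ?thesis .
qed

theorem theorem2p2:
  shows "modified_Kazhdan_constant F_2_3 \<le> 1 \<and>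
    (\<forall>\<delta>::real. 0 < \<delta> \<and> \<delta> < 1/2 \<longrightarrow>
      (\<exists>\<mu>. circle_prob_measure \<mu> \<and> continuous_measure \<mu> \<and> nonneg_fourier_coeffs \<mu> \<and>
        (INF (k::nat, k'::nat) \<in> UNIV. Re (fourier_coeff \<mu> (2 ^ k * 3 ^ k'))) > \<delta>))"
proof (intro conjI allI impI)
  show "modified_Kazhdan_constant F_2_3 \<le> 1"
  proof (rule ennreal_le_epsilon)
    fix e :: real
    assume "0 < e"
    \<comment> \<open>The cap 1/4 keeps \<open>1/2 - t\<close> in the range where a measure exists.
      A coefficient bound above \<open>1/2 - t\<close> gives squared distances below
      \<open>1 + 2 * t\<close>, hence below the square of \<open>1 + e\<close>.\<close>
    define t where "t = min e (1 / 4)"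
    have t: "0 < t" "t \<le> e" "t \<le> 1 / 4"
      using \<open>0 < e\<close> by (auto simp: t_def)
    obtain \<mu> \<delta>' where \<mu>: "circle_prob_measure \<mu>" "continuous_measure \<mu>" "1 / 2 - t < \<delta>'"
      "\<And>k k'. \<delta>' \<le> Re (fourier_coeff \<mu> (2 ^ k * 3 ^ k'))"
      by (rule exists_furstenberg_measure[of "1 / 2 - t"]) (use t in auto)
    have "modified_Kazhdan_constant F_2_3 \<le> ennreal (sqrt (2 - 2 * \<delta>'))"
      using \<mu>(4) by (intro modified_Kazhdan_constant_fourier[OF \<mu>(1,2)]) (auto simp: F_2_3_def)
    also have "\<dots> \<le> ennreal (1 + e)"
    proof (intro ennreal_leI real_le_lsqrt)
      have "2 - 2 * \<delta>' \<le> 1 + 2 * e"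
        using \<mu>(3) t by simp
      then show "2 - 2 * \<delta>' \<le> (1 + e)\<^sup>2"
        by (simp add: power2_sum add_increasing)
    qed (use \<open>0 < e\<close> in auto)
    finally show "modified_Kazhdan_constant F_2_3 \<le> 1 + ennreal e"
      using \<open>0 < e\<close> by (simp add: ennreal_plus)
  qed
next
  fix \<delta> :: real
  assume \<delta>: "0 < \<delta> \<and> \<delta> < 1/2"
  obtain \<mu> \<delta>' where \<mu>: "circle_prob_measure \<mu>" "continuous_measure \<mu>" "nonneg_fourier_coeffs \<mu>"
    "\<delta> < \<delta>'" "\<And>k k'. \<delta>' \<le> Re (fourier_coeff \<mu> (2 ^ k * 3 ^ k'))"
    by (rule exists_furstenberg_measure[of \<delta>]) (use \<delta> in auto)
  \<comment> \<open>The infimum inherits only the weak inequality; strictness comes from the gap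
    between \<delta> and \<delta>'.\<close>
  have "\<delta>' \<le> (INF (k::nat, k'::nat) \<in> UNIV. Re (fourier_coeff \<mu> (2 ^ k * 3 ^ k')))"
    using \<mu>(5) by (intro cINF_greatest) auto
  then show "\<exists>\<mu>. circle_prob_measure \<mu> \<and> continuous_measure \<mu> \<and> nonneg_fourier_coeffs \<mu> \<and>
      (INF (k::nat, k'::nat) \<in> UNIV. Re (fourier_coeff \<mu> (2 ^ k * 3 ^ k'))) > \<delta>"
    using \<mu>(1-4) by (intro exI[of _ \<mu>]) auto
qed

end
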